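(* Let $\beta$ be an $n$-braid, given by a braid diagram (a word in the Artin generators and their inverses) with $n_+$ positive crossings and $n_-$ negative crossings, and let $\overline\beta$ be its closure in the thickened annulus. Then $$\chi_{SKh}(\overline{\beta})|_{k=n-2}=(qt)^{n-2}\,q^{\,n_{+}-n_{-}}\,\operatorname{Tr}\left(\Phi(\beta,q^{2})\right),$$ where $\Phi(\beta,q^2)$ is the unreduced Burau matrix of $\beta$ with its variable set equal to $q^2$, and $\chi_{SKh}(\overline\beta)|_{k=n-2}$ is the part of the graded Euler characteristic of the sutured (annular) Khovanov homology of $\overline\beta$ in $k$-grading $n-2$.
   Context: **Braids.** $B_n$ is the $n$-strand braid group with standard Artin generators $\sigma_1,\dots,\sigma_{n-1}$; with all strands oriented in the same direction, $\sigma_i$ is a positive crossing between strands $i,i+1$ and $\sigma_i^{-1}$ a negative one. $\overline\beta$ is the closure of $\beta$, embedded in the natural way in a thickened annulus $A\times I$ (braid axis through the centre of $A$). **Burau representation.** $\Phi(\cdot,s)$ is the classical unreduced Burau representation of $B_n$ with variable $s$: the homomorphism to $GL_n(\mathbb Z[s^{\pm1}])$ sending $\sigma_i$ to the block diagonal matrix $I_{i-1}\oplus\begin{pmatrix}1-s&s\\1&0\end{pmatrix}\oplus I_{n-i-1}$. **Sutured (annular) Khovanov homology** (coefficients in $\mathbb{Z}/2\mathbb{Z}$). Let $D\subset A$ be a diagram of an oriented link in $A\times I$ with $N$ crossings, $n_+$ positive and $n_-$ negative. For each $\mathcal I\in\{0,1\}^N$ resolve the crossings by the usual Khovanov rule (the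 orientation-compatible resolution is the 0-resolution of a positive crossing and the 1-resolution of a negative crossing). To each circle of the resolution assign $V=\langle v_+,v_-\rangle$, and to the vertex $\mathcal I$ assign the tensor product of these spaces over the circles. The $q$-grading of a generator is the sum of $\pm1$ over its factors $v_\pm$, plus the number $i(\mathcal I)$ of 1's in $\mathcal I$, plus $n_+-2n_-$. The homological grading is $i(\mathcal I)-n_-$. The $k$-grading is additive over tensor factors: $v_\pm$ has $k$-grading $\pm1$ on a circle that does not bound a disk in $A$ (non-trivial circle), and $0$ on a circle that bounds a disk in $A$ (trivial circle). The standard Khovanov differential (merge: $v_+\otimes v_+\mapsto v_+$, $v_\pm\otimes v_\mp\mapsto v_-$, $v_-\otimes v_-\mapsto0$; split: $v_+\mapsto v_+\otimes v_-+v_-\otimes v_+$, $v_-\mapsto v_-\otimes v_-$) is non-increasing in the $k$-grading; $SKh$ is the homology of the associated graded complex (i.e. with only the $k$-preserving part of the differential). It is a triply graded invariant of the link in $A\times I$. **Euler characteristic.** $\chi_{SKh}(\mathbb L)=\sum_{i,j,k}(-1)^iq^jt^k\dim SKh(\mathbb L)^{i,j,k}$, where $i,j,k$ are the homological, $q$- and $k$-gradings; $\chi_{SKh}(\mathbb L)|_{k=n-2}$ is the sum of the terms with $k=n-2$. *)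

theory Defs
  imports
    "HOL-Library.Poly_Mapping"
    "HOL-Library.Product_Plus"
    "HOL-Library.Z2"
    "Jordan_Normal_Form.Matrix"
begin

section \<open>Braid words\<close>

text \<open>
  The letter \<open>(i, True)\<close> stands for the Artin generator \<open>\<sigma>\<^sub>i\<close> and \<open>(i, False)\<close> for its inverse.
\<close>

type_synonym braid_word = "(nat \<times> bool) list"

definition is_braid_word :: "nat \<Rightarrow> braid_word \<Rightarrow> bool" where
  "is_braid_word n w \<longleftrightarrow> (\<forall>(i, e) \<in> set w. 1 \<le> i \<and> i < n)"

definition n_pos :: "braid_word \<Rightarrow> nat" where
  "n_pos w = length (filter (\<lambda>(i, e). e) w)"

definition n_neg :: "braid_word \<Rightarrow> nat" where
  "n_neg w = length (filter (\<lambda>(i, e). \<not> e) w)"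


section \<open>The Burau representation\<close>

text \<open>
  The variable \<open>s\<close> and its inverse \<open>s'\<close> range over any commutative ring; only arguments
  with \<open>s * s' = 1\<close> are meaningful.
\<close>

definition burau_block :: "'a::comm_ring_1 \<Rightarrow> 'a \<Rightarrow> bool \<Rightarrow> 'a mat" where
  "burau_block s s' e =
     (if e then mat_of_rows_list 2 [[1 - s, s], [1, 0]]
      else mat_of_rows_list 2 [[0, 1], [s', 1 - s']])"

lemma burau_block_inverse:
  assumes "s * s' = 1"
  shows "burau_block s s' True * burau_block s s' False = 1\<^sub>m 2"
    and "burau_block s s' False * burau_block s s' True = 1\<^sub>m 2"
  using assms
  by (auto intro!: eq_matI simp: burau_block_def mat_of_rows_list_def scalar_prod_def
      less_2_cases_iff algebra_simps)

definition burau_letter :: "'a::comm_ring_1 \<Rightarrow> 'a \<Rightarrow> nat \<Rightarrow> nat \<times> bool \<Rightarrow> 'a mat" where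
  "burau_letter s s' n a =
     (case a of (i, e) \<Rightarrow> diag_block_mat [1\<^sub>m (i - 1), burau_block s s' e, 1\<^sub>m (n - i - 1)])"

definition burau :: "'a::comm_ring_1 \<Rightarrow> 'a \<Rightarrow> nat \<Rightarrow> braid_word \<Rightarrow> 'a mat" where
  "burau s s' n w = foldr (\<lambda>a M. burau_letter s s' n a * M) w (1\<^sub>m n)"

definition mat_trace :: "'a::comm_monoid_add mat \<Rightarrow> 'a" where
  "mat_trace A = (\<Sum>i<dim_row A. A $$ (i, i))"


section \<open>Resolutions of the closure of a braid word\<close>

text \<open>
  The closed braid diagram of a word of length \<open>N\<close> on \<open>n\<close> strands is cut by the radial arcs
  (``rays'') \<open>0, \<dots>, N\<close> of the annulus. The \<open>l\<close>-th letter (\<open>l < N\<close>, counting from \<open>0\<close>) lies between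
  the rays \<open>l\<close> and \<open>l + 1\<close>; between ray \<open>N\<close> and ray \<open>0\<close> the \<open>n\<close> strands run in parallel. The node
  \<open>(p, l)\<close> is the point where the \<open>p\<close>-th strand position (\<open>1 \<le> p \<le> n\<close>) meets the ray \<open>l\<close>.
  The gap \<open>(g, l)\<close> with \<open>0 \<le> g \<le> n\<close> is the open interval of the ray \<open>l\<close> between the nodes \<open>(g, l)\<close>
  and \<open>(g + 1, l)\<close>, so \<open>(0, l)\<close> and \<open>(n, l)\<close> touch the two boundary circles of the annulus.

  A resolution is given by the set \<open>I\<close> of the crossings that are \<open>1\<close>-resolved. The
  resolution of a crossing that is compatible with the orientation consists of two parallel strands;
  the other one consists of a cap and a cup, which merges the gaps on the two sides
  of the crossing and cuts the gap in the middle.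
\<close>

definition oriented_at :: "braid_word \<Rightarrow> nat set \<Rightarrow> nat \<Rightarrow> bool" where
  "oriented_at w I c \<longleftrightarrow> (snd (w ! c) \<longleftrightarrow> c \<notin> I)"

definition nodes :: "nat \<Rightarrow> braid_word \<Rightarrow> (nat \<times> nat) set" where
  "nodes n w = {1..n} \<times> {0..length w}"

definition resolution_arcs ::
  "nat \<Rightarrow> braid_word \<Rightarrow> nat set \<Rightarrow> ((nat \<times> nat) \<times> (nat \<times> nat)) set" where
  "resolution_arcs n w I =
     {((p, l), (p, Suc l)) | p l. p \<in> {1..n} \<and> l < length w \<and>
        (oriented_at w I l \<or> p \<notin> {fst (w ! l), Suc (fst (w ! l))})}
   \<union> {((i, m), (Suc i, m)) | i l m. l < length w \<and> i = fst (w ! l) \<and> m \<in> {l, Suc l} \<and>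
        \<not> oriented_at w I l}
   \<union> {((p, length w), (p, 0)) | p. p \<in> {1..n}}"

definition circles :: "nat \<Rightarrow> braid_word \<Rightarrow> nat set \<Rightarrow> (nat \<times> nat) set set" where
  "circles n w I = nodes n w // (resolution_arcs n w I \<union> (resolution_arcs n w I)\<inverse>)\<^sup>*"

definition gaps :: "nat \<Rightarrow> braid_word \<Rightarrow> (nat \<times> nat) set" where
  "gaps n w = {0..n} \<times> {0..length w}"

definition gap_links ::
  "nat \<Rightarrow> braid_word \<Rightarrow> nat set \<Rightarrow> ((nat \<times> nat) \<times> (nat \<times> nat)) set" where
  "gap_links n w I =
     {((g, l), (g, Suc l)) | g l. g \<in> {0..n} \<and> l < length w \<and>
        (oriented_at w I l \<or> g \<noteq> fst (w ! l))}
   \<union> {((i - 1, l), (i + 1, l)) | i l. l < length w \<and> i = fst (w ! l) \<and> \<not> oriented_at w I l}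
   \<union> {((g, length w), (g, 0)) | g. g \<in> {0..n}}"

text \<open>
  Every complementary region of the resolved diagram meets a ray, and two gaps lie in the same region
  iff they are connected through \<open>gap_links\<close>. So a set \<open>D\<close> of gaps closed under these links is a union
  of complementary regions. The circle \<open>C\<close> bounds a disk in the annulus iff there is such a
  \<open>D\<close> that stays away from the boundary of the annulus and whose frontier is \<open>C\<close>, i.e. such
  that passing through a node changes from the inside to the outside of \<open>D\<close> exactly at the nodes of \<open>C\<close>.
  (A compact subsurface of the interior of an annulus whose frontier is one simple closed curve is a
  disk. Other circles may lie inside \<open>D\<close>.)
\<close>

definition bounds_disk :: "nat \<Rightarrow> braid_word \<Rightarrow> nat set \<Rightarrow> (nat \<times> nat) set \<Rightarrow> bool" where
  "bounds_disk n w I C \<longleftrightarrow>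
     (\<exists>D \<subseteq> gaps n w.
        (\<forall>(x, y) \<in> gap_links n w I. x \<in> D \<longleftrightarrow> y \<in> D) \<and>
        (\<forall>l \<le> length w. (0, l) \<notin> D \<and> (n, l) \<notin> D) \<and>
        (\<forall>(p, l) \<in> nodes n w. (p, l) \<in> C \<longleftrightarrow> ((p - 1, l) \<in> D) \<noteq> ((p, l) \<in> D)))"

definition nontrivial_circles :: "nat \<Rightarrow> braid_word \<Rightarrow> nat set \<Rightarrow> (nat \<times> nat) set set" where
  "nontrivial_circles n w I = {C \<in> circles n w I. \<not> bounds_disk n w I C}"


section \<open>Annular Khovanov homology\<close>

text \<open>
  A generator \<open>(I, P)\<close> is the tensor product, at the vertex \<open>I\<close> of the cube, of the factors \<open>v\<^sub>+\<close> for the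
  circles in \<open>P\<close> and \<open>v\<^sub>-\<close> for all other circles.
\<close>

type_synonym skh_gen = "nat set \<times> (nat \<times> nat) set set"

definition skh_gens :: "nat \<Rightarrow> braid_word \<Rightarrow> skh_gen set" where
  "skh_gens n w = {(I, P). I \<subseteq> {..<length w} \<and> P \<subseteq> circles n w I}"

definition v_sign :: "(nat \<times> nat) set set \<Rightarrow> (nat \<times> nat) set \<Rightarrow> int" where
  "v_sign P C = (if C \<in> P then 1 else - 1)"

fun h_grade :: "braid_word \<Rightarrow> skh_gen \<Rightarrow> int" where
  "h_grade w (I, P) = int (card I) - int (n_neg w)"

fun q_grade :: "nat \<Rightarrow> braid_word \<Rightarrow> skh_gen \<Rightarrow> int" where
  "q_grade n w (I, P) =
     (\<Sum>C\<in>circles n w I. v_sign P C) + int (card I) + int (n_pos w) - 2 * int (n_neg w)"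

fun k_grade :: "nat \<Rightarrow> braid_word \<Rightarrow> skh_gen \<Rightarrow> int" where
  "k_grade n w (I, P) = (\<Sum>C\<in>nontrivial_circles n w I. v_sign P C)"

text \<open>
  \<open>khovanov_term n w x y\<close> states that the generator \<open>y\<close> has coefficient \<open>1\<close> (and not \<open>0\<close>) in the
  Khovanov differential of the generator \<open>x\<close>. Circles that do not pass through the crossing
  \<open>c\<close> are the same sets of nodes before and after the change of the resolution at \<open>c\<close>.
\<close>

definition merge_term ::
  "(nat \<times> nat) set \<Rightarrow> (nat \<times> nat) set \<Rightarrow> (nat \<times> nat) set set \<Rightarrow> (nat \<times> nat) set set \<Rightarrow> bool" where
  "merge_term A B P Q \<longleftrightarrow>
     (A \<in> P \<and> B \<in> P \<and> A \<union> B \<in> Q) \<or> ((A \<in> P) \<noteq> (B \<in> P) \<and> A \<union> B \<notin> Q)"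

definition split_term ::
  "(nat \<times> nat) set \<Rightarrow> (nat \<times> nat) set \<Rightarrow> (nat \<times> nat) set set \<Rightarrow> (nat \<times> nat) set set \<Rightarrow> bool" where
  "split_term A B P Q \<longleftrightarrow>
     (A \<union> B \<in> P \<and> (A \<in> Q) \<noteq> (B \<in> Q)) \<or> (A \<union> B \<notin> P \<and> A \<notin> Q \<and> B \<notin> Q)"

fun khovanov_term :: "nat \<Rightarrow> braid_word \<Rightarrow> skh_gen \<Rightarrow> skh_gen \<Rightarrow> bool" where
  "khovanov_term n w (I, P) (J, Q) \<longleftrightarrow>
     (\<exists>c < length w. c \<notin> I \<and> J = insert c I) \<and>
     P \<inter> (circles n w I \<inter> circles n w J) = Q \<inter> (circles n w I \<inter> circles n w J) \<and>
     (\<exists>A B. A \<noteq> B \<and>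
        (circles n w I - circles n w J = {A, B} \<and> circles n w J - circles n w I = {A \<union> B} \<and>
           merge_term A B P Q
       \<or> circles n w I - circles n w J = {A \<union> B} \<and> circles n w J - circles n w I = {A, B} \<and>
           split_term A B P Q))"

text \<open>
  Chains are finite formal linear combinations of generators over the field with two elements.
\<close>

definition f2_scale :: "bit \<Rightarrow> ('a \<Rightarrow>\<^sub>0 bit) \<Rightarrow> ('a \<Rightarrow>\<^sub>0 bit)" where
  "f2_scale c f = Poly_Mapping.map ((*) c) f"

lemma lookup_f2_scale: "Poly_Mapping.lookup (f2_scale c f) x = c * Poly_Mapping.lookup f x"
  by (simp add: f2_scale_def Poly_Mapping.map.rep_eq when_def)

global_interpretation f2: vector_space f2_scale
  by unfold_locales
    (auto intro!: poly_mapping_eqI simp: lookup_f2_scale lookup_add algebra_simps)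

definition skh_diff :: "nat \<Rightarrow> braid_word \<Rightarrow> (skh_gen \<Rightarrow>\<^sub>0 bit) \<Rightarrow> (skh_gen \<Rightarrow>\<^sub>0 bit)" where
  "skh_diff n w f =
     (\<Sum>x\<in>Poly_Mapping.keys f.
      \<Sum>y | y \<in> skh_gens n w \<and> khovanov_term n w x y \<and> k_grade n w y = k_grade n w x.
        Poly_Mapping.single y (Poly_Mapping.lookup f x))"

definition skh_chains :: "nat \<Rightarrow> braid_word \<Rightarrow> int \<Rightarrow> int \<Rightarrow> int \<Rightarrow> (skh_gen \<Rightarrow>\<^sub>0 bit) set" where
  "skh_chains n w i j k =
     {f. Poly_Mapping.keys f \<subseteq>
        {x \<in> skh_gens n w. h_grade w x = i \<and> q_grade n w x = j \<and> k_grade n w x = k}}"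

definition skh_cycles :: "nat \<Rightarrow> braid_word \<Rightarrow> int \<Rightarrow> int \<Rightarrow> int \<Rightarrow> (skh_gen \<Rightarrow>\<^sub>0 bit) set" where
  "skh_cycles n w i j k = {f \<in> skh_chains n w i j k. skh_diff n w f = 0}"

definition skh_boundaries :: "nat \<Rightarrow> braid_word \<Rightarrow> int \<Rightarrow> int \<Rightarrow> int \<Rightarrow> (skh_gen \<Rightarrow>\<^sub>0 bit) set" where
  "skh_boundaries n w i j k = skh_diff n w ` skh_chains n w (i - 1) j k"

text \<open>
  The boundaries form a subspace of the finite-dimensional space of cycles, so the
  difference is the dimension of the homology group in tridegree \<open>(i, j, k)\<close>.
\<close>

definition skh_dim :: "nat \<Rightarrow> braid_word \<Rightarrow> int \<Rightarrow> int \<Rightarrow> int \<Rightarrow> int" where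
  "skh_dim n w i j k = int (f2.dim (skh_cycles n w i j k)) - int (f2.dim (skh_boundaries n w i j k))"


section \<open>The graded Euler characteristic\<close>

text \<open>
  Laurent polynomials over the integers in \<open>q\<close> and \<open>t\<close>, as the group ring of \<open>int \<times> int\<close>.
\<close>

type_synonym laurent_qt = "(int \<times> int) \<Rightarrow>\<^sub>0 int"

definition qt_monom :: "int \<Rightarrow> int \<Rightarrow> laurent_qt" \<comment> \<open>\<open>q\<^sup>a t\<^sup>b\<close>\<close> where
  "qt_monom a b = Poly_Mapping.single (a, b) 1"

lemma qt_monom_mult: "qt_monom a b * qt_monom c d = qt_monom (a + c) (b + d)"
  by (simp add: qt_monom_def mult_single)

lemma qt_monom_0: "qt_monom 0 0 = 1"
  by (simp add: qt_monom_def flip: single_one zero_prod_def)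

text \<open>
  The sum of the terms with \<open>k = m\<close> of the Euler characteristic. \<open>Sum_any\<close> is the sum over
  the finitely many pairs \<open>(i, j)\<close> with a nonzero term.
\<close>

definition skh_euler_at :: "nat \<Rightarrow> braid_word \<Rightarrow> int \<Rightarrow> laurent_qt" where
  "skh_euler_at n w m =
     Sum_any (\<lambda>(i, j). of_int ((if even i then 1 else - 1) * skh_dim n w i j m) * qt_monom j m)"

end

theory Submission
  imports Defs
begin

text \<open>
  Both sides are sums over the \<open>2\<^sup>N\<close> resolutions of the \<open>N\<close> crossings, and these sums agree term
  by term. Call a crossing a turnback of a resolution if it is resolved into a cup and a cap,
  against the orientation.

  \<^emph>\<open>Homology.\<close> By rank and nullity the Euler characteristic of the homology is that of the chain
  complex, a signed sum over generators (\<open>euler_characteristic_eq_generators\<close>). Let a resolution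
  have \<open>r\<close> nontrivial and \<open>m\<close> trivial circles. A circle is trivial iff it meets a ray of the
  annulus an even number of times (\<open>bounds_disk_iff_even\<close>), and a ray has \<open>n\<close> nodes in all. So
  \<open>r \<le> n\<close>, and a turnback, which puts two nodes of one ray on one circle, lowers the bound to \<open>n
  - 2\<close>. In \<open>k\<close>-grading \<open>n - 2\<close> there are three cases. Without turnbacks \<open>r = n\<close>, and one of the
  \<open>n\<close> circles carries \<open>v\<^sub>-\<close>. If \<open>r = n - 2\<close>, all nontrivial circles carry \<open>v\<^sub>+\<close> and the trivial
  ones are free, which gives \<open>q\<^sup>n\<^sup>-\<^sup>2 (q + q\<^sup>-\<^sup>1)\<^sup>m\<close>. If \<open>r < n - 2\<close>, there is no generator.

  \<^emph>\<open>Burau matrix.\<close> At \<open>s = q\<^sup>2\<close> the matrices of \<open>\<sigma>\<^sub>i\<close> and \<open>\<sigma>\<^sub>i\<^sup>-\<^sup>1\<close> are \<open>1 - A\<^sub>i\<close> and \<open>1 - q\<^sup>-\<^sup>2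
  A\<^sub>i\<close> with the same matrix \<open>A\<^sub>i\<close> of rank one; the \<open>A\<^sub>i\<close> represent cup-cap pairs as in the
  Temperley-Lieb algebra. Expanding the product gives a sum over the set of crossings at which
  \<open>A\<^sub>i\<close> is taken, which is the set of turnbacks of a unique resolution. The trace of a product
  of rank one matrices is the cyclic product of the pairings of neighbours; once the factors are
  suitably rescaled, \<open>A\<^sub>i\<close> and \<open>A\<^sub>j\<close> pair to \<open>q (q + q\<^sup>-\<^sup>1)\<close>, \<open>q\<close> or \<open>0\<close> as \<open>\<bar>i - j\<bar>\<close> is \<open>0\<close>,
  \<open>1\<close> or larger (\<open>burau_trace_expansion\<close>).

  \<^emph>\<open>Comparison.\<close> Without turnbacks both terms are \<open>n\<close> up to a monomial. If two cyclically
  consecutive turnbacks are at least two positions apart, a ray between them meets two disjoint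
  pairs of joined nodes, so \<open>r \<le> n - 4\<close> and both terms vanish (\<open>nontrivial_circles_far_turns\<close>).
  In the remaining case the strands that are not caught by a turnback close up to \<open>n - 2\<close>
  nontrivial circles, and each pair of consecutive turnbacks in the same position bounds one
  trivial circle (\<open>circles_near_turns\<close>); so both terms are \<open>(q + q\<^sup>-\<^sup>1)\<^sup>m\<close> up to a monomial. The
  signs and the powers of \<open>q\<close> are matched in \<open>letter_coeffs_monomial\<close>.
\<close>

section \<open>The Euler characteristic as a sum over generators\<close>

context vector_space
begin

text \<open>
  The bound from above maps a basis of \<open>V\<close> that extends one of the kernel; the bound from below
  lifts a basis of the image back to \<open>V\<close>.
\<close>
lemma dim_kernel_plus_dim_image:
  assumes f: "Vector_Spaces.linear scale scale f" and V: "subspace V" "V \<subseteq> span W" "finite W"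
  shows "dim {x \<in> V. f x = 0} + dim (f ` V) = dim V"
proof -
  interpret f: Vector_Spaces.linear scale scale f by (rule f)
  let ?Z = "{x \<in> V. f x = 0}"
  obtain K where K: "K \<subseteq> ?Z" "independent K" "?Z \<subseteq> span K" "card K = dim ?Z"
    by (rule basis_exists)
  have "K \<subseteq> V" using K(1) by blast
  then obtain B where B: "K \<subseteq> B" "B \<subseteq> V" "independent B" "V \<subseteq> span B"
    using K(2) by (rule maximal_independent_subset_extend)
  have finB: "finite B"
    using independent_span_bound[OF V(3) B(3)] B(2) V(2) by auto
  have finK: "finite K" using B(1) finB by (rule finite_subset)
  have card_B: "card B = dim V"
    using B by (intro basis_card_eq_dim) auto
  have "f ` B \<subseteq> span (f ` (B - K))"
  proof (rule image_subsetI)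
    fix b assume "b \<in> B"
    moreover have "f b = 0" if "b \<in> K" using that K(1) by auto
    ultimately show "f b \<in> span (f ` (B - K))"
      by (cases "b \<in> K") (auto intro: span_base simp: span_zero)
  qed
  then have "f ` V \<subseteq> span (f ` (B - K))"
    using image_mono[OF B(4), of f] f.span_image[of B]
      span_minimal[of "f ` B" "span (f ` (B - K))"] by simp
  then have "dim (f ` V) \<le> card (f ` (B - K))"
    using finB by (intro dim_le_card) auto
  also have "\<dots> \<le> card (B - K)"
    using finB by (intro card_image_le) auto
  also have "\<dots> = dim V - dim ?Z"
    using B(1) finK by (simp add: card_Diff_subset card_B K(4))
  finally have upper: "dim (f ` V) \<le> dim V - dim ?Z" .
  have "dim ?Z \<le> dim V"
    using card_mono[OF finB B(1)] K(4) card_B by simp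
  obtain D where D: "D \<subseteq> f ` V" "independent D" "f ` V \<subseteq> span D" "card D = dim (f ` V)"
    by (rule basis_exists)
  have finD: "finite D"
    using D(1) \<open>f ` V \<subseteq> span (f ` (B - K))\<close> finB
    by (intro conjunct1[OF independent_span_bound[OF _ D(2), of "f ` (B - K)"]]) auto
  obtain g where g: "\<And>d. d \<in> D \<Longrightarrow> g d \<in> V \<and> f (g d) = d"
    using D(1) by (metis (no_types, lifting) image_iff subsetD)
  have "V \<subseteq> span (K \<union> g ` D)"
  proof
    fix v assume v: "v \<in> V"
    have "f ` g ` D = D" using g by force
    then have "f v \<in> f ` span (g ` D)"
      using v D(3) f.span_image[of "g ` D"] by auto
    then obtain u where u: "u \<in> span (g ` D)" "f v = f u" by auto
    have "span (g ` D) \<subseteq> V"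
      using g V(1) by (intro span_minimal) auto
    then have "v - u \<in> ?Z" using u v V(1) by (auto simp: subspace_diff f.diff)
    then have "v - u \<in> span (K \<union> g ` D)"
      using K(3) span_mono[of K "K \<union> g ` D"] by blast
    moreover have "u \<in> span (K \<union> g ` D)"
      using u(1) span_mono[of "g ` D" "K \<union> g ` D"] by blast
    ultimately have "v - u + u \<in> span (K \<union> g ` D)" by (rule span_add)
    then show "v \<in> span (K \<union> g ` D)" by simp
  qed
  then have "dim V \<le> card (K \<union> g ` D)"
    using finK finD by (intro dim_le_card) auto
  also have "\<dots> \<le> card K + card D"
    using card_Un_le[of K "g ` D"] card_image_le[OF finD, of g] by linarith
  finally show ?thesis
    using upper \<open>dim ?Z \<le> dim V\<close> K(4) D(4) by simp
qed

end

lemma linear_skh_diff: "Vector_Spaces.linear f2_scale f2_scale (skh_diff n w)"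
proof -
  define F where "F x = (\<Sum>y | y \<in> skh_gens n w \<and> khovanov_term n w x y \<and> k_grade n w y = k_grade n w x.
    Poly_Mapping.single y (1 :: bit))" for x
  have diff: "skh_diff n w f = (\<Sum>x\<in>A. f2_scale (Poly_Mapping.lookup f x) (F x))"
    if "finite A" "Poly_Mapping.keys f \<subseteq> A" for f A
  proof -
    have single: "Poly_Mapping.single y c = f2_scale c (Poly_Mapping.single y 1)" for y :: skh_gen and c
      by (rule poly_mapping_eqI) (simp add: lookup_f2_scale lookup_single when_def)
    have "skh_diff n w f = (\<Sum>x\<in>Poly_Mapping.keys f. f2_scale (Poly_Mapping.lookup f x) (F x))"
      unfolding skh_diff_def F_def f2.scale_sum_right
      by (intro sum.cong refl) (rule single)
    also have "\<dots> = (\<Sum>x\<in>A. f2_scale (Poly_Mapping.lookup f x) (F x))"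
      using that by (intro sum.mono_neutral_left) (auto simp: in_keys_iff)
    finally show ?thesis .
  qed
  show ?thesis
    unfolding Vector_Spaces.linear_iff
  proof (intro conjI allI f2.vector_space_axioms)
    fix f g :: "skh_gen \<Rightarrow>\<^sub>0 bit"
    let ?A = "Poly_Mapping.keys f \<union> Poly_Mapping.keys g"
    have "finite ?A" "Poly_Mapping.keys (f + g) \<subseteq> ?A"
      by (auto simp: Poly_Mapping.keys_add)
    then show "skh_diff n w (f + g) = skh_diff n w f + skh_diff n w g"
      using diff[of ?A f] diff[of ?A g] diff[of ?A "f + g"]
      by (simp only: lookup_add f2.scale_left_distrib sum.distrib) simp
  next
    fix c and f :: "skh_gen \<Rightarrow>\<^sub>0 bit"
    have "Poly_Mapping.keys (f2_scale c f) \<subseteq> Poly_Mapping.keys f"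
      by (auto simp: in_keys_iff lookup_f2_scale)
    then show "skh_diff n w (f2_scale c f) = f2_scale c (skh_diff n w f)"
      by (simp add: diff[of "Poly_Mapping.keys f"] lookup_f2_scale f2.scale_sum_right)
  qed
qed

text \<open>
  Linear combinations of the basis vectors are read off coordinatewise, which settles spanning
  and independence in the following lemma.
\<close>
lemma lookup_sum_scaled_singles:
  assumes "finite G"
  shows "Poly_Mapping.lookup (\<Sum>x\<in>G. f2_scale (c x) (Poly_Mapping.single x 1)) y = (if y \<in> G then c y else 0)"
proof -
  have "Poly_Mapping.lookup (\<Sum>x\<in>G. f2_scale (c x) (Poly_Mapping.single x 1)) y
      = (\<Sum>x\<in>G. if x = y then c x else 0)"
    unfolding lookup_sum by (intro sum.cong) (auto simp: lookup_f2_scale lookup_single)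
  then show ?thesis using assms by simp
qed

lemma dim_supported_on:
  fixes G :: "'a set"
  assumes "finite G"
  shows "f2.subspace {f. Poly_Mapping.keys f \<subseteq> G}"
    and "{f. Poly_Mapping.keys f \<subseteq> G} \<subseteq> f2.span ((\<lambda>x. Poly_Mapping.single x 1) ` G)"
    and "f2.dim {f :: 'a \<Rightarrow>\<^sub>0 bit. Poly_Mapping.keys f \<subseteq> G} = card G"
proof -
  let ?e = "\<lambda>x. Poly_Mapping.single x (1 :: bit)"
  let ?V = "{f :: 'a \<Rightarrow>\<^sub>0 bit. Poly_Mapping.keys f \<subseteq> G}"
  show sub: "f2.subspace ?V"
    by (auto simp: f2.subspace_def lookup_f2_scale in_keys_iff lookup_add subset_iff) 
  have expand: "f = (\<Sum>x\<in>G. f2_scale (Poly_Mapping.lookup f x) (?e x))" if "f \<in> ?V" for f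
  proof (rule poly_mapping_eqI)
    fix y
    have "y \<notin> G \<Longrightarrow> Poly_Mapping.lookup f y = 0" using that by (auto simp: in_keys_iff)
    then show "Poly_Mapping.lookup f y = Poly_Mapping.lookup (\<Sum>x\<in>G. f2_scale (Poly_Mapping.lookup f x) (?e x)) y"
      using assms by (simp add: lookup_sum_scaled_singles)
  qed
  show span: "?V \<subseteq> f2.span (?e ` G)"
  proof
    fix f assume "f \<in> ?V"
    moreover have "(\<Sum>x\<in>G. f2_scale (Poly_Mapping.lookup f x) (?e x)) \<in> f2.span (?e ` G)"
      by (intro f2.span_sum f2.span_scale) (simp add: f2.span_base)
    ultimately show "f \<in> f2.span (?e ` G)" using expand by simp
  qed
  have inj: "inj_on ?e G"
    by (rule inj_onI) (metis lookup_single_eq lookup_single_not_eq one_neq_zero)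
  have "f2.independent (?e ` G)"
  proof (rule f2.independent_if_scalars_zero)
    show "finite (?e ` G)" using assms by simp
    fix c v assume eq: "(\<Sum>x\<in>?e ` G. f2_scale (c x) x) = 0" and "v \<in> ?e ` G"
    then obtain y where y: "y \<in> G" "v = ?e y" by auto
    have "0 = Poly_Mapping.lookup (\<Sum>x\<in>G. f2_scale (c (?e x)) (?e x)) y"
      using eq by (simp add: sum.reindex[OF inj])
    also have "\<dots> = c v"
      using assms y by (simp add: lookup_sum_scaled_singles)
    finally show "c v = 0" by simp
  qed
  moreover have "?e ` G \<subseteq> ?V" by auto
  ultimately show "f2.dim ?V = card G"
    using f2.dim_unique[of "?e ` G" ?V "card G"] span card_image[OF inj] by simp
qed

lemma finite_nodes: "finite (nodes n w)"
  by (simp add: nodes_def)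

lemma finite_circles: "finite (circles n w I)"
  unfolding circles_def quotient_def by (simp add: finite_nodes)

lemma finite_skh_gens: "finite (skh_gens n w)"
proof -
  have "skh_gens n w = Sigma (Pow {..<length w}) (\<lambda>I. Pow (circles n w I))"
    by (auto simp: skh_gens_def)
  then show ?thesis by (auto simp: finite_circles intro!: finite_SigmaI)
qed

definition gens_at :: "nat \<Rightarrow> braid_word \<Rightarrow> int \<Rightarrow> int \<Rightarrow> int \<Rightarrow> skh_gen set" where
  "gens_at n w i j k = {x \<in> skh_gens n w. h_grade w x = i \<and> q_grade n w x = j \<and> k_grade n w x = k}"

text \<open>
  The boundaries are the image of the chains in degree \<open>i - 1\<close>, so their dimension is that of
  these chains minus that of the cycles. In the alternating sum over \<open>i\<close> the two cycle terms
  cancel.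
\<close>
lemma skh_dim_eq:
  "skh_dim n w i j k = int (f2.dim (skh_cycles n w i j k)) + int (f2.dim (skh_cycles n w (i - 1) j k))
     - int (card (gens_at n w (i - 1) j k))"
proof -
  let ?G = "gens_at n w (i - 1) j k"
  have fin: "finite ?G" by (simp add: gens_at_def finite_skh_gens)
  have chains: "skh_chains n w (i - 1) j k = {f. Poly_Mapping.keys f \<subseteq> ?G}"
    by (simp add: skh_chains_def gens_at_def)
  note supp = dim_supported_on[OF fin]
  show ?thesis
    using f2.dim_kernel_plus_dim_image[OF linear_skh_diff supp(1) supp(2), of n w] supp(3) fin
    by (simp add: skh_dim_def skh_boundaries_def skh_cycles_def chains)
qed

lemma gens_at_nonempty_finite:
  "finite {(i, j). gens_at n w i j k \<noteq> {}}"
proof (rule finite_subset)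
  show "{(i, j). gens_at n w i j k \<noteq> {}} \<subseteq> (\<lambda>x. (h_grade w x, q_grade n w x)) ` skh_gens n w"
    unfolding gens_at_def by blast
qed (simp add: finite_skh_gens)

lemma euler_characteristic_eq_generators:
  "skh_euler_at n w k =
     (\<Sum>x | x \<in> skh_gens n w \<and> k_grade n w x = k.
        of_int (if even (h_grade w x) then 1 else - 1) * qt_monom (q_grade n w x) k)"
proof -
  define sg :: "int \<Rightarrow> int" where "sg i = (if even i then 1 else - 1)" for i
  define z where "z p = int (f2.dim (skh_cycles n w (fst p) (snd p) k))" for p
  define a where "a p = int (card (gens_at n w (fst p) (snd p) k))" for p
  define m where "m p = (of_int (sg (fst p)) * qt_monom (snd p) k :: laurent_qt)" for p
  \<comment> \<open>The term at \<open>(i, j)\<close> is \<open>T (i, j) - U (i - 1, j)\<close>. Shifting the index of \<open>U\<close> cancels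
    the cycle dimensions \<open>z\<close> and leaves the chain dimensions \<open>a\<close>.\<close>
  define T where "T p = of_int (z p) * m p" for p
  define U where "U p = of_int (z p - a p) * m p" for p
  let ?P = "{p. gens_at n w (fst p) (snd p) k \<noteq> {}}"
  have finP: "finite ?P"
    using gens_at_nonempty_finite[of n w k] by (simp add: case_prod_unfold)
  have z0: "z p = 0" and a0: "a p = 0" if "p \<notin> ?P" for p
  proof -
    have "skh_cycles n w (fst p) (snd p) k \<subseteq> {0}"
      using that unfolding skh_cycles_def skh_chains_def by (auto simp flip: gens_at_def)
    then show "z p = 0" using f2.dim_le_card[of "skh_cycles n w (fst p) (snd p) k" "{}"]
      by (simp add: z_def)
    show "a p = 0" using that by (simp add: a_def)
  qed
  have finT: "finite {p. T p \<noteq> 0}" and finU: "finite {p. U p \<noteq> 0}"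
    by (rule finite_subset[OF _ finP]; auto simp: T_def U_def z0 a0)+
  let ?s = "\<lambda>p :: int \<times> int. (fst p - 1, snd p)"
  have bij: "bij ?s"
    by (rule bij_betw_byWitness[where f' = "\<lambda>p. (fst p + 1, snd p)"]) auto
  have finU': "finite {p. U (?s p) \<noteq> 0}"
    using finite_vimageI[OF finU bij_is_inj[OF bij]] by (simp add: vimage_def)
  have "skh_euler_at n w k = Sum_any (\<lambda>p. T p - U (?s p))"
  proof -
    have "(case p of (i, j) \<Rightarrow> of_int ((if even i then 1 else - 1) * skh_dim n w i j k) * qt_monom j k)
        = T p - U (?s p)" for p
    proof (cases p)
      case (Pair i j)
      have "sg (i - 1) = - sg i" by (simp add: sg_def)
      then show ?thesis
        unfolding Pair skh_dim_eq T_def U_def m_def z_def a_def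
        by (simp add: sg_def[of i, symmetric]) (simp add: algebra_simps)
    qed
    then show ?thesis by (simp add: skh_euler_at_def)
  qed
  also have "\<dots> = Sum_any T + Sum_any (\<lambda>p. - U (?s p))"
    using Sum_any.distrib[OF finT, of "\<lambda>p. - U (?s p)"] finU' by simp
  also have "Sum_any (\<lambda>p. - U (?s p)) = Sum_any (\<lambda>p. - U p)"
    using bij by (rule Sum_any.reindex_cong[symmetric]) (simp add: fun_eq_iff)
  also have "Sum_any T + Sum_any (\<lambda>p. - U p) = Sum_any (\<lambda>p. T p + - U p)"
    using finT finU by (intro Sum_any.distrib[symmetric]) auto
  also have "(\<lambda>p. T p + - U p) = (\<lambda>p. of_int (a p) * m p)"
    by (simp add: fun_eq_iff T_def U_def algebra_simps)
  also have "Sum_any (\<lambda>p. of_int (a p) * m p) = (\<Sum>p\<in>?P. of_int (a p) * m p)"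
    using finP by (intro Sum_any.expand_superset) (auto simp: a_def)
  also have "\<dots> = (\<Sum>p\<in>?P. \<Sum>x\<in>{x \<in> {x \<in> skh_gens n w. k_grade n w x = k}. (h_grade w x, q_grade n w x) = p}.
      m (h_grade w x, q_grade n w x))"
  proof (rule sum.cong[OF refl])
    fix p
    have "{x \<in> {x \<in> skh_gens n w. k_grade n w x = k}. (h_grade w x, q_grade n w x) = p}
        = gens_at n w (fst p) (snd p) k"
      by (auto simp: gens_at_def)
    moreover have "(\<Sum>x\<in>gens_at n w (fst p) (snd p) k. m (h_grade w x, q_grade n w x))
        = (\<Sum>x\<in>gens_at n w (fst p) (snd p) k. m p)"
      by (intro sum.cong) (auto simp: gens_at_def)
    ultimately show "of_int (a p) * m p
        = (\<Sum>x\<in>{x \<in> {x \<in> skh_gens n w. k_grade n w x = k}. (h_grade w x, q_grade n w x) = p}.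
            m (h_grade w x, q_grade n w x))"
      by (simp add: a_def)
  qed
  also have "\<dots> = (\<Sum>x | x \<in> skh_gens n w \<and> k_grade n w x = k. m (h_grade w x, q_grade n w x))"
  proof (rule sum.group)
    show "(\<lambda>x. (h_grade w x, q_grade n w x)) ` {x \<in> skh_gens n w. k_grade n w x = k} \<subseteq> ?P"
    proof (rule image_subsetI, rule CollectI)
      fix x assume "x \<in> {x \<in> skh_gens n w. k_grade n w x = k}"
      then have "x \<in> gens_at n w (h_grade w x) (q_grade n w x) k"
        unfolding gens_at_def by blast
      then show "gens_at n w (fst (h_grade w x, q_grade n w x)) (snd (h_grade w x, q_grade n w x)) k \<noteq> {}"
        by auto
    qed
  qed (use finP finite_skh_gens[of n w] in auto)
  finally show ?thesis by (simp add: m_def sg_def)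
qed

section \<open>Cyclic neighbours in a set of positions\<close>

text \<open>
  Position \<open>l\<close> lies immediately before the letter \<open>l\<close>, so a member \<open>l\<close> of \<open>S\<close> is its own
  successor but not its own predecessor, unless \<open>S\<close> has no other member. When there is no
  suitable member on the requested side, the search wraps around the closure of the braid, and
  the outermost member from the other end is taken.
\<close>
definition prev_in :: "nat set \<Rightarrow> nat \<Rightarrow> nat" where
  "prev_in S l = (if \<exists>c\<in>S. c < l then Max {c \<in> S. c < l} else Max S)"

definition next_in :: "nat set \<Rightarrow> nat \<Rightarrow> nat" where
  "next_in S l = (if \<exists>c\<in>S. l \<le> c then Min {c \<in> S. l \<le> c} else Min S)"

lemma prev_in_mem:
  assumes "finite S" "S \<noteq> {}"
  shows "prev_in S l \<in> S"
proof (cases "\<exists>c\<in>S. c < l")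
  case True
  then have "Max {c \<in> S. c < l} \<in> {c \<in> S. c < l}"
    using assms by (intro Max_in) auto
  then show ?thesis using True by (simp add: prev_in_def)
next
  case False
  then show ?thesis using assms by (simp add: prev_in_def)
qed

lemma next_in_mem:
  assumes "finite S" "S \<noteq> {}"
  shows "next_in S l \<in> S"
proof (cases "\<exists>c\<in>S. l \<le> c")
  case True
  then have "Min {c \<in> S. l \<le> c} \<in> {c \<in> S. l \<le> c}"
    using assms by (intro Min_in) auto
  then show ?thesis using True by (simp add: next_in_def)
next
  case False
  then show ?thesis using assms by (simp add: next_in_def)
qed

lemma prev_in_Suc_mem:
  assumes "finite S" "l \<in> S"
  shows "prev_in S (Suc l) = l"
  using assms by (auto simp: prev_in_def intro!: Max_eqI)

lemma prev_in_Suc_not_mem: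
  assumes "l \<notin> S"
  shows "prev_in S (Suc l) = prev_in S l"
proof -
  have "c < Suc l \<longleftrightarrow> c < l" if "c \<in> S" for c
    using that assms by (cases "c = l") auto
  then have "{c \<in> S. c < Suc l} = {c \<in> S. c < l}" "(\<exists>c\<in>S. c < Suc l) \<longleftrightarrow> (\<exists>c\<in>S. c < l)"
    by auto
  then show ?thesis by (simp add: prev_in_def)
qed

lemma next_in_self:
  assumes "finite S" "l \<in> S"
  shows "next_in S l = l"
  using assms by (auto simp: next_in_def intro!: Min_eqI)

lemma next_in_Suc_not_mem:
  assumes "l \<notin> S"
  shows "next_in S (Suc l) = next_in S l"
proof -
  have "Suc l \<le> c \<longleftrightarrow> l \<le> c" if "c \<in> S" for c
    using that assms by (cases "c = l") auto
  then have "{c \<in> S. Suc l \<le> c} = {c \<in> S. l \<le> c}" "(\<exists>c\<in>S. Suc l \<le> c) \<longleftrightarrow> (\<exists>c\<in>S. l \<le> c)"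
    by auto
  then show ?thesis by (simp add: next_in_def)
qed

lemma prev_in_wrap:
  assumes "S \<subseteq> {..<N}"
  shows "prev_in S N = prev_in S 0"
proof -
  have "{c \<in> S. c < N} = S" using assms by auto
  then show ?thesis by (simp add: prev_in_def)
qed

lemma next_in_wrap:
  assumes "S \<subseteq> {..<N}"
  shows "next_in S N = next_in S 0"
proof -
  have "\<not> (\<exists>c\<in>S. N \<le> c)" using assms by auto
  then show ?thesis by (simp add: next_in_def)
qed

text \<open>
  Going around the annulus: a property that is created at each member of \<open>S\<close>, is passed on
  across the other positions and survives the wrap from \<open>N\<close> to \<open>0\<close> holds everywhere, since a
  tour of the circle started at a member of \<open>S\<close> reaches every position.
\<close>
lemma cyclic_induct [consumes 3, case_names start step wrap]:
  assumes S: "S \<subseteq> {..<N}" "S \<noteq> {}" and l: "l \<le> N"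
    and start: "\<And>c. c \<in> S \<Longrightarrow> P (Suc c)"
    and step: "\<And>l. l < N \<Longrightarrow> l \<notin> S \<Longrightarrow> P l \<Longrightarrow> P (Suc l)"
    and wrap: "P N \<Longrightarrow> P 0"
  shows "P l"
proof -
  have up: "P m" if "l \<le> m" "m \<le> N" "P l" for l m
    using that
  proof (induction m rule: dec_induct)
    case (step m)
    then show ?case using start[of m] assms(5)[of m] by (cases "m \<in> S") auto
  qed auto
  obtain c where "c \<in> S" using S by auto
  with S start have "P (Suc c)" "Suc c \<le> N" by auto
  then have "P N" using up by blast
  then have "P 0" by (rule wrap)
  then show ?thesis using up l by blast
qed

lemma cyclic_induct_backward [consumes 3, case_names start step wrap]:
  assumes S: "S \<subseteq> {..<N}" "S \<noteq> {}" and l: "l \<le> N"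
    and start: "\<And>c. c \<in> S \<Longrightarrow> P c"
    and step: "\<And>l. l < N \<Longrightarrow> l \<notin> S \<Longrightarrow> P (Suc l) \<Longrightarrow> P l"
    and wrap: "P 0 \<Longrightarrow> P N"
  shows "P l"
proof -
  have down: "P l" if "l \<le> m" "m \<le> N" "P m" for l m
    using that
  proof (induction l rule: inc_induct)
    case (step l)
    then show ?case using start[of l] assms(5)[of l] by (cases "l \<in> S") auto
  qed auto
  obtain c where "c \<in> S" using S by auto
  with S start have "P c" "c \<le> N" by auto
  then have "P 0" using down by blast
  then have "P N" by (rule wrap)
  then show ?thesis using down l by blast
qed

text \<open>
  All positions in a segment between two consecutive members of \<open>S\<close> see the same successor; so
  the segment that starts at \<open>c\<close> ends at \<open>next_in S (Suc c)\<close>.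
\<close>
lemma next_in_prev_in:
  assumes S: "S \<subseteq> {..<N}" "S \<noteq> {}" and l: "l \<le> N"
  shows "next_in S (Suc (prev_in S l)) = next_in S l"
  using S l
proof (induction l rule: cyclic_induct)
  case (start c)
  then show ?case using finite_subset[OF S(1)] by (simp add: prev_in_Suc_mem)
next
  case (step l)
  then show ?case by (simp add: prev_in_Suc_not_mem next_in_Suc_not_mem)
next
  case wrap
  then show ?case using S by (simp add: prev_in_wrap next_in_wrap)
qed

lemma braid_letter_bounds:
  assumes "is_braid_word n w" "c < length w"
  shows "1 \<le> fst (w ! c)" "fst (w ! c) < n"
proof -
  have "(fst (w ! c), snd (w ! c)) \<in> set w" using assms(2) by simp
  then show "1 \<le> fst (w ! c)" "fst (w ! c) < n"
    using assms(1) unfolding is_braid_word_def by fastforce+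
qed


section \<open>State sum for the trace of the Burau matrix\<close>

text \<open>
  The rank one matrix \<open>A\<^sub>i\<close> with entries \<open>burau_col s i a * burau_row i b\<close> has the block with
  rows \<open>(s, -s)\<close> and \<open>(-1, 1)\<close> in the rows and columns \<open>i - 1\<close> and \<open>i\<close>, counted from \<open>0\<close>.
\<close>
definition burau_col :: "'a::comm_ring_1 \<Rightarrow> nat \<Rightarrow> nat \<Rightarrow> 'a" where
  "burau_col s i a = (if a = i - 1 then s else if a = i then - 1 else 0)"

definition burau_row :: "nat \<Rightarrow> nat \<Rightarrow> 'a::comm_ring_1" where
  "burau_row i b = (if b = i - 1 then 1 else if b = i then - 1 else 0)"

definition letter_coeff :: "'a::comm_ring_1 \<Rightarrow> bool \<Rightarrow> 'a" where
  "letter_coeff s' e = (if e then - 1 else - s')"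

lemma burau_block_entries:
  "dim_row (burau_block s s' e) = 2" "dim_col (burau_block s s' e) = 2"
  "burau_block s s' e $$ (0, 0) = (if e then 1 - s else 0)"
  "burau_block s s' e $$ (0, Suc 0) = (if e then s else 1)"
  "burau_block s s' e $$ (Suc 0, 0) = (if e then 1 else s')"
  "burau_block s s' e $$ (Suc 0, Suc 0) = (if e then 0 else 1 - s')"
  by (cases e; simp add: burau_block_def mat_of_rows_list_def)+

lemma burau_letter_carrier:
  assumes "1 \<le> i" "i < n"
  shows "burau_letter s s' n (i, e) \<in> carrier_mat n n"
  using assms
  by (intro carrier_matI) (simp_all add: burau_letter_def dim_diag_block_mat burau_block_entries(1,2))

text \<open>
  A generator and its inverse differ from the identity by multiples of the same rank one matrix.
  For the inverse this uses \<open>s * s' = 1\<close>.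
\<close>
lemma burau_letter_entry:
  fixes s s' :: "'a::comm_ring_1"
  assumes "1 \<le> i" "i < n" "s * s' = 1" "a < n" "b < n"
  shows "burau_letter s s' n (i, e) $$ (a, b) =
    of_bool (a = b) + letter_coeff s' e * (burau_col s i a * burau_row i b)"
proof -
  have s: "s' * s = 1" using assms(3) by (simp add: mult.commute)
  obtain k where k: "i = Suc k" using assms(1) by (cases i) auto
  obtain m where m: "n = k + 2 + m"
    using assms(2) k by (metis Suc_leI add_2_eq_Suc' le_iff_add)
  have letter: "burau_letter s s' n (i, e) = four_block_mat (1\<^sub>m k) (0\<^sub>m k (2 + m)) (0\<^sub>m (2 + m) k)
      (four_block_mat (burau_block s s' e) (0\<^sub>m 2 m) (0\<^sub>m m 2) (1\<^sub>m m))"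
  proof -
    have cons: "diag_block_mat (A # B # Bs) = four_block_mat A
        (0\<^sub>m (dim_row A) (dim_col (diag_block_mat (B # Bs))))
        (0\<^sub>m (dim_row (diag_block_mat (B # Bs))) (dim_col A)) (diag_block_mat (B # Bs))"
      for A B :: "'a mat" and Bs
      by (simp add: Let_def)
    show ?thesis
      by (simp add: burau_letter_def k m cons burau_block_entries(1,2) del: diag_block_mat.simps(2))
  qed
  have inner: "four_block_mat (burau_block s s' e) (0\<^sub>m 2 m) (0\<^sub>m m 2) (1\<^sub>m m) $$ (a - k, b - k) =
      (if a - k < 2 then if b - k < 2 then burau_block s s' e $$ (a - k, b - k) else 0
       else if b - k < 2 then 0 else of_bool (a = b))" if "k \<le> a" "k \<le> b"
  proof -
    have "(a - k - 2 = b - k - 2) \<longleftrightarrow> a = b" if "\<not> a - k < 2" "\<not> b - k < 2"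
      using that by arith
    moreover have "a - k < 2 + m" "b - k < 2 + m" "\<not> a - k < 2 \<Longrightarrow> a - k - 2 < m"
      "\<not> b - k < 2 \<Longrightarrow> b - k - 2 < m"
      using assms(4,5) m that by arith+
    ultimately show ?thesis
      by (simp add: burau_block_entries(1,2))
  qed
  have entry: "burau_letter s s' n (i, e) $$ (a, b) =
      (if a < k then if b < k then of_bool (a = b) else 0
       else if b < k then 0
       else if a - k < 2 then if b - k < 2 then burau_block s s' e $$ (a - k, b - k) else 0
       else if b - k < 2 then 0 else of_bool (a = b))"
  proof -
    have "a < k + (2 + m)" "b < k + (2 + m)" "\<not> a < k \<Longrightarrow> a - k < 2 + m" "\<not> b < k \<Longrightarrow> b - k < 2 + m"
      using assms(4,5) m by arith+
    then show ?thesis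
      unfolding letter by (simp add: inner burau_block_entries(1,2)) arith
  qed
  have cases: "c < k \<or> c = k \<or> c = Suc k \<or> \<not> c < k \<and> c \<noteq> k \<and> c \<noteq> Suc k \<and> \<not> c - k < 2" for c
    by arith
  show ?thesis
    using cases[of a] cases[of b] s unfolding entry
    by (elim disjE)
      (simp_all add: k burau_block_entries burau_col_def burau_row_def letter_coeff_def)
qed

text \<open>
  The entry at \<open>(a, b)\<close> of the product, over the letters before \<open>l\<close>, of the rank one matrix
  where the letter belongs to \<open>S\<close> and of the identity elsewhere.
\<close>
fun tl_prod :: "'a::comm_ring_1 \<Rightarrow> nat \<Rightarrow> braid_word \<Rightarrow> nat set \<Rightarrow> nat \<Rightarrow> nat \<Rightarrow> nat \<Rightarrow> 'a" where
  "tl_prod s n w S 0 a b = of_bool (a = b)"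
| "tl_prod s n w S (Suc l) a b =
     (if l \<in> S then (\<Sum>c<n. tl_prod s n w S l a c * (burau_col s (fst (w ! l)) c * burau_row (fst (w ! l)) b))
      else tl_prod s n w S l a b)"

lemma tl_prod_cong:
  assumes "S \<inter> {..<l} = T \<inter> {..<l}"
  shows "tl_prod s n w S l a b = tl_prod s n w T l a b"
  using assms
proof (induction l arbitrary: b)
  case (Suc l)
  then have "S \<inter> {..<l} = T \<inter> {..<l}" "l \<in> S \<longleftrightarrow> l \<in> T" by auto
  then show ?case using Suc.IH by simp
qed simp

lemma sum_Pow_lessThan_Suc:
  fixes F :: "nat set \<Rightarrow> 'a::comm_monoid_add"
  shows "(\<Sum>S\<in>Pow {..<Suc l}. F S) = (\<Sum>S\<in>Pow {..<l}. F S + F (insert l S))"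
proof -
  have inj: "inj_on (insert l) (Pow {..<l})"
    by (rule inj_onI) (metis Pow_iff insert_ident lessThan_iff less_irrefl subsetD)
  have "Pow {..<Suc l} = Pow {..<l} \<union> insert l ` Pow {..<l}"
    by (simp add: lessThan_Suc Pow_insert)
  also have "(\<Sum>S\<in>\<dots>. F S) = (\<Sum>S\<in>Pow {..<l}. F S) + (\<Sum>S\<in>insert l ` Pow {..<l}. F S)"
    by (rule sum.union_disjoint) auto
  finally show ?thesis
    by (simp add: sum.reindex[OF inj] sum.distrib)
qed

lemma burau_append_letter:
  assumes "is_braid_word n (w @ [x])"
  shows "burau s s' n w \<in> carrier_mat n n"
    and "burau s s' n (w @ [x]) = burau s s' n w * burau_letter s s' n x"
proof -
  have letter: "burau_letter s s' n y \<in> carrier_mat n n" if "y \<in> set (w @ [x])" for y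
  proof -
    have "1 \<le> fst y" "fst y < n"
      using that assms unfolding is_braid_word_def by (auto split: prod.splits)
    then show ?thesis
      using burau_letter_carrier[of "fst y" n s s' "snd y"] by simp
  qed
  have fold: "foldr (\<lambda>a M. burau_letter s s' n a * M) v M
      = foldr (\<lambda>a M. burau_letter s s' n a * M) v (1\<^sub>m n) * M
      \<and> foldr (\<lambda>a M. burau_letter s s' n a * M) v (1\<^sub>m n) \<in> carrier_mat n n"
    if "set v \<subseteq> set (w @ [x])" "M \<in> carrier_mat n n" for v M
    using that
  proof (induction v)
    case Nil
    then show ?case by simp
  next
    case (Cons y v)
    then have "burau_letter s s' n y \<in> carrier_mat n n" using letter by auto
    with Cons show ?case by (auto simp: assoc_mult_mat[of _ n n _ n _ n])
  qed
  have "burau_letter s s' n x \<in> carrier_mat n n" using letter by simp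
  with fold[of w "burau_letter s s' n x"] fold[of w "1\<^sub>m n"]
  show "burau s s' n w \<in> carrier_mat n n"
    and "burau s s' n (w @ [x]) = burau s s' n w * burau_letter s s' n x"
    by (auto simp: burau_def)
qed

lemma burau_carrier:
  assumes "is_braid_word n w"
  shows "burau s s' n w \<in> carrier_mat n n"
proof (cases w rule: rev_cases)
  case Nil
  then show ?thesis by (simp add: burau_def)
next
  case (snoc v x)
  with assms burau_append_letter[of n v x s s'] burau_letter_carrier[of "fst x" n s s' "snd x"]
  show ?thesis by (auto simp: is_braid_word_def)
qed

lemma burau_take_entry:
  fixes s s' :: "'a::comm_ring_1"
  assumes w: "is_braid_word n w" and s: "s * s' = 1" and "l \<le> length w" "a < n" "b < n"
  shows "burau s s' n (take l w) $$ (a, b) =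
    (\<Sum>S\<in>Pow {..<l}. (\<Prod>c\<in>S. letter_coeff s' (snd (w ! c))) * tl_prod s n w S l a b)"
  using assms(3-)
proof (induction l arbitrary: b)
  case 0
  then show ?case by (simp add: burau_def)
next
  case (Suc l)
  define i e where "i = fst (w ! l)" and "e = snd (w ! l)"
  let ?K = "\<lambda>S. \<Prod>c\<in>S. letter_coeff s' (snd (w ! c))"
  let ?B = "burau s s' n (take l w)"
  have l: "l < length w" using Suc.prems by simp
  then have x: "w ! l = (i, e)" "(i, e) \<in> set w"
    by (auto simp: i_def e_def)
  then have i: "1 \<le> i" "i < n" using w by (auto simp: is_braid_word_def)
  have take: "take (Suc l) w = take l w @ [(i, e)]"
    using l by (simp add: take_Suc_conv_app_nth x)
  have "set (take (Suc l) w) \<subseteq> set w" by (rule set_take_subset)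
  then have "is_braid_word n (take l w @ [(i, e)])"
    using w unfolding is_braid_word_def take[symmetric] by auto
  note B = burau_append_letter[OF this, of s s']
  have IH: "?B $$ (a, c) = (\<Sum>S\<in>Pow {..<l}. ?K S * tl_prod s n w S l a c)" if "c < n" for c
    using Suc.IH[of c] Suc.prems that by simp
  have "burau s s' n (take (Suc l) w) $$ (a, b)
      = (\<Sum>c<n. ?B $$ (a, c) * burau_letter s s' n (i, e) $$ (c, b))"
    using B burau_letter_carrier[OF i, of s s' e] Suc.prems
    by (simp add: take scalar_prod_def lessThan_atLeast0)
  also have "\<dots> = (\<Sum>c<n. ?B $$ (a, c) * of_bool (c = b))
      + (\<Sum>c<n. ?B $$ (a, c) * (letter_coeff s' e * (burau_col s i c * burau_row i b)))"
    using i s Suc.prems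
    by (simp add: burau_letter_entry distrib_left sum.distrib)
  also have "(\<Sum>c<n. ?B $$ (a, c) * of_bool (c = b)) = ?B $$ (a, b)"
    using Suc.prems by (simp add: of_bool_def if_distrib[of "\<lambda>x. _ * x"] cong: if_cong)
  also have "(\<Sum>c<n. ?B $$ (a, c) * (letter_coeff s' e * (burau_col s i c * burau_row i b)))
      = (\<Sum>S\<in>Pow {..<l}. letter_coeff s' e * ?K S *
          (\<Sum>c<n. tl_prod s n w S l a c * (burau_col s i c * burau_row i b)))"
    by (simp add: IH sum_distrib_left sum_distrib_right sum.swap[of _ "{..<n}"] algebra_simps)
  also have "\<dots> = (\<Sum>S\<in>Pow {..<l}. ?K (insert l S) * tl_prod s n w (insert l S) (Suc l) a b)"
  proof (rule sum.cong[OF refl])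
    fix S assume S: "S \<in> Pow {..<l}"
    then have "l \<notin> S" "finite S" by (auto intro: finite_subset)
    moreover have "tl_prod s n w (insert l S) l a c = tl_prod s n w S l a c" for c
      by (rule tl_prod_cong) auto
    ultimately show "letter_coeff s' e * ?K S *
        (\<Sum>c<n. tl_prod s n w S l a c * (burau_col s i c * burau_row i b))
      = ?K (insert l S) * tl_prod s n w (insert l S) (Suc l) a b"
      by (simp add: x)
  qed
  also have "?B $$ (a, b) = (\<Sum>S\<in>Pow {..<l}. ?K S * tl_prod s n w S (Suc l) a b)"
    using Suc.prems by (subst IH) (auto intro!: sum.cong)
  finally show ?case
    by (simp only: sum_Pow_lessThan_Suc sum.distrib)
qed

text \<open>
  With \<open>x = q\<close> and \<open>y = q\<^sup>-\<^sup>1\<close> this is the value of the part of a closed Temperley-Lieb diagram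
  between a cup at \<open>i\<close> and the next cap at \<open>j\<close> in the second highest weight: a trivial circle, a
  straightened zigzag, or zero.
\<close>
definition loop_weight :: "'a::comm_ring_1 \<Rightarrow> 'a \<Rightarrow> nat \<Rightarrow> nat \<Rightarrow> 'a" where
  "loop_weight x y i j = (if i = j then x + y else if i = Suc j \<or> j = Suc i then 1 else 0)"

text \<open>
  The factors of the rank one matrices are rescaled by \<open>(-x)\<^sup>\<plusminus>\<^sup>i\<close>, which leaves the matrices
  unchanged as \<open>y\<close> is the inverse of \<open>x\<close>. The unscaled pairing of neighbours is \<open>-x\<^sup>2\<close> or \<open>-1\<close>,
  depending on the direction of the step; after rescaling it is \<open>x\<close> in both directions, so
  upward and downward steps of the cyclic sequence need not be counted.
\<close>
definition balanced_col :: "'a::comm_ring_1 \<Rightarrow> 'a \<Rightarrow> nat \<Rightarrow> nat \<Rightarrow> 'a" where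
  "balanced_col x y i a = (- y) ^ i * burau_col (x ^ 2) i a"

definition balanced_row :: "'a::comm_ring_1 \<Rightarrow> nat \<Rightarrow> nat \<Rightarrow> 'a" where
  "balanced_row x i b = (- x) ^ i * burau_row i b"

lemma power_mult_inverse:
  fixes x y :: "'a::comm_ring_1"
  assumes "x * y = 1"
  shows "(- x) ^ i * (- y) ^ i = 1"
  using assms by (simp flip: power_mult_distrib)

lemma balanced_col_row:
  fixes x y :: "'a::comm_ring_1"
  assumes "x * y = 1"
  shows "balanced_col x y i a * balanced_row x i b = burau_col (x ^ 2) i a * burau_row i b"
proof -
  have "balanced_col x y i a * balanced_row x i b
      = ((- x) ^ i * (- y) ^ i) * (burau_col (x ^ 2) i a * burau_row i b)"
    by (simp only: balanced_col_def balanced_row_def ac_simps)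
  then show ?thesis using power_mult_inverse[OF assms] by simp
qed

lemma balanced_row_col:
  fixes x y :: "'a::comm_ring_1"
  assumes xy: "x * y = 1" and i: "1 \<le> i" "i < n" and j: "1 \<le> j" "j < n"
  shows "(\<Sum>a<n. balanced_row x i a * balanced_col x y j a) = x * loop_weight x y i j"
proof -
  have *: "(\<Sum>a<n. burau_row i a * burau_col (x ^ 2) j a)
      = burau_col (x ^ 2) j (i - 1) - burau_col (x ^ 2) j i" (is "sum ?f _ = _")
  proof -
    have "(\<Sum>a<n. ?f a) = (\<Sum>a\<in>{i - 1, i}. ?f a)"
      using i by (intro sum.mono_neutral_right) (auto simp: burau_row_def)
    then show ?thesis using i by (simp add: burau_row_def)
  qed
  have "(\<Sum>a<n. balanced_row x i a * balanced_col x y j a)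
      = (- x) ^ i * (- y) ^ j * (\<Sum>a<n. ?f a)"
    by (simp add: balanced_row_def balanced_col_def sum_distrib_left ac_simps)
  also have "\<dots> = (- x) ^ i * (- y) ^ j * (burau_col (x ^ 2) j (i - 1) - burau_col (x ^ 2) j i)"
    by (simp add: *)
  also have "\<dots> = x * loop_weight x y i j"
  proof -
    consider "i = j" | "i = Suc j" | "j = Suc i" | "i \<noteq> j" "i \<noteq> Suc j" "j \<noteq> Suc i" by blast
    then show ?thesis
    proof cases
      case 1
      then show ?thesis using i power_mult_inverse[OF xy, of i] xy
        by (auto simp: burau_col_def loop_weight_def power2_eq_square algebra_simps)
    next
      case 2
      then show ?thesis using j power_mult_inverse[OF xy, of j]
        by (auto simp: burau_col_def loop_weight_def mult.assoc)
    next
      case 3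
      have "(- x) ^ i * (- y) ^ Suc i * - (x ^ 2)
          = ((- x) ^ i * (- y) ^ i) * ((x * y) * x)"
        by (simp add: power2_eq_square)
      also have "\<dots> = x" by (simp only: power_mult_inverse[OF xy] xy mult_1)
      finally show ?thesis using 3 i
        by (auto simp: burau_col_def loop_weight_def)
    next
      case 4
      then show ?thesis using i j
        by (auto simp: burau_col_def loop_weight_def)
    qed
  qed
  finally show ?thesis .
qed

text \<open>
  A product of rank one matrices is the outer product of its first column and its last row,
  times the pairings of the neighbours in between. The members of \<open>S\<close> before \<open>l\<close> other than the
  last one are those whose successor has been multiplied already.
\<close>
lemma tl_prod_closed:
  fixes x y :: "'a::comm_ring_1"
  assumes xy: "x * y = 1" and w: "is_braid_word n w" and S: "S \<subseteq> {..<length w}" "S \<noteq> {}"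
    and "l \<le> length w" "a < n"
  shows "tl_prod (x ^ 2) n w S l a b =
    (if \<exists>c\<in>S. c < l then
       (\<Prod>c\<in>{c \<in> S. c < l} - {prev_in S l}.
          x * loop_weight x y (fst (w ! c)) (fst (w ! next_in S (Suc c)))) *
       (balanced_col x y (fst (w ! next_in S 0)) a * balanced_row x (fst (w ! prev_in S l)) b)
     else of_bool (a = b))"
  using assms(5-)
proof (induction l arbitrary: b)
  case 0
  then show ?case by simp
next
  case (Suc l)
  have fin: "finite S" using S(1) finite_subset by blast
  have idx: "1 \<le> fst (w ! c)" "fst (w ! c) < n" if "c < length w" for c
    using braid_letter_bounds[OF w that] by auto
  show ?case
  proof (cases "l \<in> S")
    case False
    then have "c < Suc l \<longleftrightarrow> c < l" if "c \<in> S" for c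
      using that by (cases "c = l") auto
    then have "{c \<in> S. c < Suc l} = {c \<in> S. c < l}" "(\<exists>c\<in>S. c < Suc l) \<longleftrightarrow> (\<exists>c\<in>S. c < l)"
      by auto
    with False Suc show ?thesis by (simp add: prev_in_Suc_not_mem)
  next
    case l: True
    then have prev: "prev_in S (Suc l) = l" and nxt: "next_in S l = l"
      using fin by (simp_all add: prev_in_Suc_mem next_in_self)
    let ?i = "fst (w ! l)"
    have eq: "tl_prod (x ^ 2) n w S (Suc l) a b =
       (\<Sum>c<n. tl_prod (x ^ 2) n w S l a c * (balanced_col x y ?i c * balanced_row x ?i b))"
      using l by (simp add: balanced_col_row[OF xy])
    have set: "{c \<in> S. c < Suc l} - {l} = {c \<in> S. c < l}" by auto
    have ex: "\<exists>c\<in>S. c < Suc l" using l by auto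
    show ?thesis
    proof (cases "\<exists>c\<in>S. c < l")
      case False
      then have "Min S = l" using l fin by (intro Min_eqI) (auto simp: not_less)
      then have "next_in S 0 = l" using S by (auto simp: next_in_def)
      moreover have "(\<Prod>c\<in>{c \<in> S. c < l}. x * loop_weight x y (fst (w ! c)) (fst (w ! next_in S (Suc c)))) = 1"
        using False by (intro prod.neutral) auto
      moreover have "tl_prod (x ^ 2) n w S (Suc l) a b = balanced_col x y ?i a * balanced_row x ?i b"
        unfolding eq using Suc False
        by (simp add: of_bool_def if_distrib[of "\<lambda>x. x * _"] cong: if_cong)
      ultimately show ?thesis using ex prev set by simp
    next
      case True
      let ?p = "prev_in S l"
      let ?h = "\<lambda>c. x * loop_weight x y (fst (w ! c)) (fst (w ! next_in S (Suc c)))"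
      have p: "?p \<in> {c \<in> S. c < l}"
      proof -
        have "Max {c \<in> S. c < l} \<in> {c \<in> S. c < l}"
          using True fin by (intro Max_in) auto
        then show ?thesis using True by (simp add: prev_in_def)
      qed
      have np: "next_in S (Suc ?p) = l"
        using next_in_prev_in[OF S, of l] Suc.prems nxt by simp
      have "tl_prod (x ^ 2) n w S (Suc l) a b =
          (\<Prod>c\<in>{c \<in> S. c < l} - {?p}. ?h c) * (balanced_col x y (fst (w ! next_in S 0)) a
           * balanced_row x ?i b) * (\<Sum>c<n. balanced_row x (fst (w ! ?p)) c * balanced_col x y ?i c)"
        unfolding eq using Suc True by (simp add: sum_distrib_left sum_distrib_right ac_simps)
      also have "(\<Sum>c<n. balanced_row x (fst (w ! ?p)) c * balanced_col x y ?i c) = ?h ?p"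
        using idx[of ?p] idx[of l] p S(1) l unfolding np by (intro balanced_row_col[OF xy]) auto
      also have "(\<Prod>c\<in>{c \<in> S. c < l} - {?p}. ?h c) * (balanced_col x y (fst (w ! next_in S 0)) a
           * balanced_row x ?i b) * ?h ?p
         = (\<Prod>c\<in>{c \<in> S. c < l}. ?h c) * (balanced_col x y (fst (w ! next_in S 0)) a
           * balanced_row x ?i b)"
        using p fin by (subst prod.remove[of "{c \<in> S. c < l}" ?p]) (auto simp: ac_simps)
      finally show ?thesis using ex prev set by simp
    qed
  qed
qed

definition tl_weight :: "'a::comm_ring_1 \<Rightarrow> 'a \<Rightarrow> nat \<Rightarrow> braid_word \<Rightarrow> nat set \<Rightarrow> 'a" where
  "tl_weight x y n w S = (if S = {} then of_nat n
     else (\<Prod>c\<in>S. x * loop_weight x y (fst (w ! c)) (fst (w ! next_in S (Suc c)))))"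

text \<open>
  Taking the trace pairs the last row with the first column and so closes the sequence of
  pairings cyclically.
\<close>
lemma tl_prod_trace:
  fixes x y :: "'a::comm_ring_1"
  assumes xy: "x * y = 1" and w: "is_braid_word n w" and S: "S \<subseteq> {..<length w}"
  shows "(\<Sum>a<n. tl_prod (x ^ 2) n w S (length w) a a) = tl_weight x y n w S"
proof (cases "S = {}")
  case True
  have "tl_prod (x ^ 2) n w {} l a a = 1" for l a
    by (induction l) auto
  then show ?thesis using True by (simp add: tl_weight_def)
next
  case False
  let ?N = "length w"
  let ?p = "prev_in S ?N"
  let ?h = "\<lambda>c. x * loop_weight x y (fst (w ! c)) (fst (w ! next_in S (Suc c)))"
  have fin: "finite S" using S(1) finite_subset by blast
  have idx: "1 \<le> fst (w ! c)" "fst (w ! c) < n" if "c \<in> S" for c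
    using braid_letter_bounds[OF w, of c] that S by auto
  have set: "{c \<in> S. c < ?N} = S" "\<exists>c\<in>S. c < ?N" using S False by auto
  have p: "?p \<in> S" and q: "next_in S 0 \<in> S"
    using prev_in_mem next_in_mem fin False by auto
  have np: "next_in S (Suc ?p) = next_in S 0"
    using next_in_prev_in[OF S False, of ?N] next_in_wrap[OF S] by simp
  have "(\<Sum>a<n. tl_prod (x ^ 2) n w S ?N a a)
     = (\<Prod>c\<in>S - {?p}. ?h c) *
       (\<Sum>a<n. balanced_row x (fst (w ! ?p)) a * balanced_col x y (fst (w ! next_in S 0)) a)"
    using set by (simp add: tl_prod_closed[OF xy w S False] sum_distrib_left sum_distrib_right ac_simps)
  also have "(\<Sum>a<n. balanced_row x (fst (w ! ?p)) a * balanced_col x y (fst (w ! next_in S 0)) a) = ?h ?p"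
    using idx[OF p] idx[OF q] unfolding np by (intro balanced_row_col[OF xy]) auto
  also have "(\<Prod>c\<in>S - {?p}. ?h c) * ?h ?p = (\<Prod>c\<in>S. ?h c)"
    using prod.remove[OF fin p, of ?h] by (simp only: mult.commute)
  finally show ?thesis using False by (simp add: tl_weight_def)
qed

lemma burau_trace_expansion:
  fixes x y :: "'a::comm_ring_1"
  assumes xy: "x * y = 1" and w: "is_braid_word n w"
  shows "mat_trace (burau (x ^ 2) (y ^ 2) n w) =
    (\<Sum>S\<in>Pow {..<length w}. (\<Prod>c\<in>S. letter_coeff (y ^ 2) (snd (w ! c))) * tl_weight x y n w S)"
proof -
  let ?N = "length w"
  let ?K = "\<lambda>S. \<Prod>c\<in>S. letter_coeff (y ^ 2) (snd (w ! c))"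
  have s: "x ^ 2 * y ^ 2 = 1" using xy by (simp flip: power_mult_distrib)
  have "mat_trace (burau (x ^ 2) (y ^ 2) n w) = (\<Sum>a<n. burau (x ^ 2) (y ^ 2) n (take ?N w) $$ (a, a))"
    using burau_carrier[OF w, of "x ^ 2" "y ^ 2"] by (auto simp: mat_trace_def)
  also have "\<dots> = (\<Sum>a<n. \<Sum>S\<in>Pow {..<?N}. ?K S * tl_prod (x ^ 2) n w S ?N a a)"
    by (intro sum.cong[OF refl] burau_take_entry[OF w s]) auto
  also have "\<dots> = (\<Sum>S\<in>Pow {..<?N}. ?K S * (\<Sum>a<n. tl_prod (x ^ 2) n w S ?N a a))"
    by (simp add: sum.swap[of _ "{..<n}"] sum_distrib_left)
  also have "\<dots> = (\<Sum>S\<in>Pow {..<?N}. ?K S * tl_weight x y n w S)"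
    by (intro sum.cong[OF refl]) (simp add: tl_prod_trace[OF xy w])
  finally show ?thesis .
qed

section \<open>Circles of a resolution and their intersections with rays\<close>

text \<open>
  The equivalence relation whose classes are the circles of the resolution.
\<close>
definition connected_by :: "nat \<Rightarrow> braid_word \<Rightarrow> nat set \<Rightarrow> ((nat \<times> nat) \<times> (nat \<times> nat)) set" where
  "connected_by n w I = (resolution_arcs n w I \<union> (resolution_arcs n w I)\<inverse>)\<^sup>*"

definition turnbacks :: "braid_word \<Rightarrow> nat set \<Rightarrow> nat set" where
  "turnbacks w I = {l. l < length w \<and> \<not> oriented_at w I l}"

lemma turnbacks_subset: "turnbacks w I \<subseteq> {..<length w}"
  by (auto simp: turnbacks_def)

lemma finite_turnbacks: "finite (turnbacks w I)"
  by (simp add: turnbacks_def)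

text \<open>
  The number of intersections of \<open>C\<close> with the part of the ray \<open>l\<close> up to the gap \<open>g\<close>; for \<open>g = n\<close>
  this is the whole ray.
\<close>
definition node_count :: "(nat \<times> nat) set \<Rightarrow> nat \<Rightarrow> nat \<Rightarrow> nat" where
  "node_count C l g = (\<Sum>p=1..g. of_bool ((p, l) \<in> C))"

lemma node_count_simps [simp]:
  "node_count C l 0 = 0"
  "node_count C l (Suc g) = node_count C l g + of_bool ((Suc g, l) \<in> C)"
  by (simp_all add: node_count_def)

lemma node_count_card: "node_count C l g = card {p \<in> {1..g}. (p, l) \<in> C}"
  by (simp add: node_count_def Int_def)

lemma conn_refl: "(x, x) \<in> connected_by n w I"
  by (simp add: connected_by_def)

lemma conn_sym: "(x, y) \<in> connected_by n w I \<Longrightarrow> (y, x) \<in> connected_by n w I"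
  unfolding connected_by_def by (rule symD[OF sym_rtrancl[OF sym_Un_converse]])

lemma conn_trans:
  "(x, y) \<in> connected_by n w I \<Longrightarrow> (y, z) \<in> connected_by n w I \<Longrightarrow> (x, z) \<in> connected_by n w I"
  unfolding connected_by_def by (rule rtrancl_trans)

lemma conn_arc: "(x, y) \<in> resolution_arcs n w I \<Longrightarrow> (x, y) \<in> connected_by n w I"
  by (auto simp: connected_by_def)

lemma conn_invariant:
  assumes "\<And>x y. (x, y) \<in> resolution_arcs n w I \<Longrightarrow> f x = f y"
    and "(x, y) \<in> connected_by n w I"
  shows "f x = f y"
  using assms(2) unfolding connected_by_def
  by (induction rule: rtrancl_induct) (auto dest: assms(1))

lemma conn_straight:
  assumes "p \<in> {1..n}" "l < length w" "l \<notin> turnbacks w I \<or> p \<notin> {fst (w ! l), Suc (fst (w ! l))}"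
  shows "((p, l), (p, Suc l)) \<in> connected_by n w I"
  using assms by (intro conn_arc) (auto simp: resolution_arcs_def turnbacks_def)

lemma conn_turn:
  assumes "l \<in> turnbacks w I" "m = l \<or> m = Suc l"
  shows "((fst (w ! l), m), (Suc (fst (w ! l)), m)) \<in> connected_by n w I"
  using assms by (intro conn_arc) (auto simp: resolution_arcs_def turnbacks_def)

lemma conn_wrap:
  assumes "p \<in> {1..n}"
  shows "((p, length w), (p, 0)) \<in> connected_by n w I"
  using assms by (intro conn_arc) (auto simp: resolution_arcs_def)

lemma resolution_arcs_cases [consumes 1, case_names straight turn wrap]:
  assumes "(x, y) \<in> resolution_arcs n w I"
  obtains p l where "p \<in> {1..n}" "l < length w" "x = (p, l)" "y = (p, Suc l)"
      "l \<notin> turnbacks w I \<or> p \<notin> {fst (w ! l), Suc (fst (w ! l))}"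
  | l m where "l \<in> turnbacks w I" "m = l \<or> m = Suc l" "x = (fst (w ! l), m)" "y = (Suc (fst (w ! l)), m)"
  | p where "p \<in> {1..n}" "x = (p, length w)" "y = (p, 0)"
  using assms unfolding resolution_arcs_def turnbacks_def by blast

lemma turnback_bounds:
  assumes "is_braid_word n w" "l \<in> turnbacks w I"
  shows "1 \<le> fst (w ! l)" "fst (w ! l) < n" "l < length w"
  using braid_letter_bounds[OF assms(1), of l] assms(2) by (auto simp: turnbacks_def)

lemma resolution_arcs_nodes:
  assumes w: "is_braid_word n w" and "(x, y) \<in> resolution_arcs n w I"
  shows "x \<in> nodes n w" "y \<in> nodes n w"
  using assms(2)
  by (cases rule: resolution_arcs_cases; use turnback_bounds[OF w] in \<open>fastforce simp: nodes_def\<close>)+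

lemma conn_nodes:
  assumes w: "is_braid_word n w" and "(x, y) \<in> connected_by n w I"
  shows "x \<in> nodes n w \<longleftrightarrow> y \<in> nodes n w"
  using assms(2) by (rule conn_invariant[rotated]) (use resolution_arcs_nodes[OF w] in blast)

lemma circles_image: "circles n w I = (\<lambda>x. connected_by n w I `` {x}) ` nodes n w"
  by (auto simp: circles_def quotient_def connected_by_def)

lemma circles_conn_class:
  assumes "C \<in> circles n w I" "x \<in> C"
  shows "C = connected_by n w I `` {x}"
  using assms by (auto simp: circles_image intro: conn_trans conn_sym)

definition arc_closed :: "nat \<Rightarrow> braid_word \<Rightarrow> nat set \<Rightarrow> (nat \<times> nat) set \<Rightarrow> bool" where
  "arc_closed n w I C \<longleftrightarrow> (\<forall>(x, y) \<in> resolution_arcs n w I. x \<in> C \<longleftrightarrow> y \<in> C)"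

lemma circles_arc_closed:
  assumes "C \<in> circles n w I"
  shows "arc_closed n w I C"
proof -
  obtain z where C: "C = connected_by n w I `` {z}" using assms by (auto simp: circles_image)
  have "(z, x) \<in> connected_by n w I \<longleftrightarrow> (z, y) \<in> connected_by n w I"
    if "(x, y) \<in> resolution_arcs n w I" for x y
    using conn_arc[OF that] conn_sym conn_trans by blast
  then show ?thesis by (auto simp: arc_closed_def C)
qed

text \<open>
  The circles partition the nodes; in this form the fact can be summed over a ray.
\<close>
lemma circles_cover:
  assumes x: "x \<in> nodes n w"
  shows "(\<Sum>C\<in>circles n w I. of_bool (x \<in> C) :: nat) = 1"
proof -
  let ?C = "connected_by n w I `` {x}"
  have "?C \<in> circles n w I" "x \<in> ?C" using x by (auto simp: circles_image conn_refl)
  moreover have "C = ?C" if "C \<in> circles n w I" "x \<in> C" for C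
    using circles_conn_class that by blast
  ultimately have "circles n w I \<inter> {C. x \<in> C} = {?C}" by blast
  then show ?thesis by (simp add: finite_circles)
qed

lemma sum_node_count_circles:
  assumes "l \<le> length w"
  shows "(\<Sum>C\<in>circles n w I. node_count C l n) = n"
proof -
  have "(\<Sum>C\<in>circles n w I. node_count C l n)
      = (\<Sum>p=1..n. \<Sum>C\<in>circles n w I. of_bool ((p, l) \<in> C))"
    unfolding node_count_def by (rule sum.swap)
  also have "\<dots> = (\<Sum>p=1..n. 1)"
    using assms by (intro sum.cong refl circles_cover) (auto simp: nodes_def)
  finally show ?thesis by simp
qed

text \<open>
  The parity of the number of intersections below a gap changes from one ray to the next only
  through a turnback, and a turnback always catches two nodes of the same circle on each side.
  The correction term concerns the one gap that lies between these two nodes.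
\<close>
lemma node_count_parity_across:
  assumes w: "is_braid_word n w" and C: "arc_closed n w I C" and l: "l < length w" and "g \<le> n"
  shows "even (node_count C l g + of_bool (l \<in> turnbacks w I \<and> g = fst (w ! l) \<and> (g, l) \<in> C)) \<longleftrightarrow>
    even (node_count C (Suc l) g + of_bool (l \<in> turnbacks w I \<and> g = fst (w ! l) \<and> (g, Suc l) \<in> C))"
  using assms(4)
proof (induction g)
  case 0
  show ?case using turnback_bounds[OF w, of l I] by auto
next
  case (Suc g)
  have arcs: "(p, l) \<in> C \<longleftrightarrow> (p, Suc l) \<in> C"
    if "p \<in> {1..n}" "l \<notin> turnbacks w I \<or> p \<notin> {fst (w ! l), Suc (fst (w ! l))}" for p
    using C l that unfolding arc_closed_def resolution_arcs_def turnbacks_def by blast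
  have turn: "(fst (w ! l), m) \<in> C \<longleftrightarrow> (Suc (fst (w ! l)), m) \<in> C"
    if "l \<in> turnbacks w I" "m = l \<or> m = Suc l" for m
    using C l that unfolding arc_closed_def resolution_arcs_def turnbacks_def by blast
  consider "l \<notin> turnbacks w I" | "l \<in> turnbacks w I" "Suc g = fst (w ! l)"
    | "l \<in> turnbacks w I" "g = fst (w ! l)"
    | "l \<in> turnbacks w I" "Suc g \<noteq> fst (w ! l)" "g \<noteq> fst (w ! l)" by blast
  then show ?case
  proof cases
    case 1
    then show ?thesis using Suc arcs[of "Suc g"] by auto
  next
    case 2
    then show ?thesis using Suc unfolding 2(2)[symmetric] by auto
  next
    case 3
    then show ?thesis using Suc turn[of l] turn[of "Suc l"] by auto
  next
    case 4
    then show ?thesis using Suc arcs[of "Suc g"] by auto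
  qed
qed

lemma node_count_wrap:
  assumes "arc_closed n w I C" "g \<le> n"
  shows "node_count C (length w) g = node_count C 0 g"
proof -
  have "(p, length w) \<in> C \<longleftrightarrow> (p, 0) \<in> C" if "p \<in> {1..n}" for p
    using assms(1) that unfolding arc_closed_def resolution_arcs_def by blast
  then show ?thesis using assms(2) by (auto simp: node_count_def intro!: sum.cong)
qed

lemma node_count_parity_ray:
  assumes w: "is_braid_word n w" and C: "arc_closed n w I C" and l: "l \<le> length w"
  shows "even (node_count C l n) \<longleftrightarrow> even (node_count C 0 n)"
  using l
proof (induction l)
  case (Suc l)
  have "\<not> (l \<in> turnbacks w I \<and> n = fst (w ! l))"
    using turnback_bounds[OF w] by blast
  then show ?case
    using node_count_parity_across[OF w C, of l n] Suc by auto
qed simp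

text \<open>
  This is the mod 2 winding number. A region that stays away from the inner boundary and has
  frontier \<open>C\<close> must consist of the gaps with an odd number of intersections below them; it stays
  away from the outer boundary as well iff the total number on the ray is even.
\<close>
lemma bounds_disk_iff_even:
  assumes w: "is_braid_word n w" and C: "arc_closed n w I C" and l: "l \<le> length w"
  shows "bounds_disk n w I C \<longleftrightarrow> even (node_count C l n)"
proof
  assume "bounds_disk n w I C"
  then obtain D where D: "\<forall>l\<le>length w. (0, l) \<notin> D \<and> (n, l) \<notin> D"
    "\<forall>(p, l)\<in>nodes n w. (p, l) \<in> C \<longleftrightarrow> ((p - 1, l) \<in> D) \<noteq> ((p, l) \<in> D)"
    unfolding bounds_disk_def by blast
  have "(g, l) \<in> D \<longleftrightarrow> odd (node_count C l g)" if "g \<le> n" for g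
    using that
  proof (induction g)
    case 0
    then show ?case using D(1) l by simp
  next
    case (Suc g)
    then have "(Suc g, l) \<in> nodes n w" using l by (simp add: nodes_def)
    with D(2) have "(Suc g, l) \<in> C \<longleftrightarrow> ((g, l) \<in> D) \<noteq> ((Suc g, l) \<in> D)" by force
    with Suc show ?case by auto
  qed
  from this[of n] D(1) l show "even (node_count C l n)" by simp
next
  assume even: "even (node_count C l n)"
  have even_all: "even (node_count C m n)" if "m \<le> length w" for m
    using node_count_parity_ray[OF w C] even l that by blast
  \<comment> \<open>The gaps that are separated from the inner boundary by an odd number of strands of \<open>C\<close>.\<close>
  define D where "D = {(g, l). g \<le> n \<and> l \<le> length w \<and> odd (node_count C l g)}"
  show "bounds_disk n w I C"
    unfolding bounds_disk_def
  proof (intro exI[of _ D] conjI)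
    show "D \<subseteq> gaps n w" by (auto simp: D_def gaps_def)
    show "\<forall>l\<le>length w. (0, l) \<notin> D \<and> (n, l) \<notin> D" using even_all by (auto simp: D_def)
    show "\<forall>(p, l)\<in>nodes n w. ((p, l) \<in> C) = (((p - 1, l) \<in> D) \<noteq> ((p, l) \<in> D))"
    proof clarify
      fix p l assume pl: "(p, l) \<in> nodes n w"
      then obtain g where "p = Suc g" by (cases p) (auto simp: nodes_def)
      with pl show "((p, l) \<in> C) = (((p - 1, l) \<in> D) \<noteq> ((p, l) \<in> D))"
        by (auto simp: nodes_def D_def)
    qed
    show "\<forall>(x, y)\<in>gap_links n w I. (x \<in> D) = (y \<in> D)"
    proof clarify
      fix g l g' l' assume "((g, l), (g', l')) \<in> gap_links n w I"
      then consider "g' = g" "l' = Suc l" "g \<le> n" "l < length w" "\<not> (l \<in> turnbacks w I \<and> g = fst (w ! l))"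
        | i where "g = i - 1" "g' = i + 1" "l' = l" "i = fst (w ! l)" "l \<in> turnbacks w I"
        | "g' = g" "g \<le> n" "l = length w" "l' = 0"
        unfolding gap_links_def turnbacks_def by simp blast
      then show "((g, l) \<in> D) = ((g', l') \<in> D)"
      proof cases
        case 1
        then show ?thesis using node_count_parity_across[OF w C, of l g] by (auto simp: D_def)
      next
        case 2
        have b: "1 \<le> i" "i < n" "l < length w" using turnback_bounds[OF w, of l I] 2 by auto
        have "(i, l) \<in> C \<longleftrightarrow> (Suc i, l) \<in> C"
          using C 2 unfolding arc_closed_def resolution_arcs_def turnbacks_def by blast
        moreover obtain j where j: "i = Suc j" using b by (cases i) auto
        ultimately have "odd (node_count C l (i - 1)) \<longleftrightarrow> odd (node_count C l (i + 1))"
          by auto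
        moreover have "i - 1 \<le> n" "i + 1 \<le> n" "l \<le> length w" using b by auto
        ultimately show ?thesis unfolding 2(1-3) D_def by blast
      next
        case 3
        then show ?thesis using node_count_wrap[OF C, of g] by (auto simp: D_def)
      qed
    qed
  qed
qed

lemma nontrivial_circles_eq:
  assumes "is_braid_word n w" "l \<le> length w"
  shows "nontrivial_circles n w I = {C \<in> circles n w I. odd (node_count C l n)}"
  using bounds_disk_iff_even[OF assms(1) circles_arc_closed assms(2)]
  by (auto simp: nontrivial_circles_def)

text \<open>
  The circles are determined by exhibiting a complete invariant of the connected components.
\<close>
lemma circles_eq_fibres:
  assumes w: "is_braid_word n w"
    and const: "\<And>x y. (x, y) \<in> resolution_arcs n w I \<Longrightarrow> f x = f y"
    and conn: "\<And>x y. x \<in> nodes n w \<Longrightarrow> y \<in> nodes n w \<Longrightarrow> f x = f y \<Longrightarrow> (x, y) \<in> connected_by n w I"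
  shows "circles n w I = (\<lambda>a. {x \<in> nodes n w. f x = a}) ` f ` nodes n w"
proof -
  have "connected_by n w I `` {x} = {y \<in> nodes n w. f y = f x}" if "x \<in> nodes n w" for x
  proof -
    have "(x, y) \<in> connected_by n w I \<longleftrightarrow> y \<in> nodes n w \<and> f y = f x" for y
      using conn_nodes[OF w, of x y I] conn_invariant[of n w I f x y] const conn[of x y] that
      by metis
    then show ?thesis by (simp add: Image_def)
  qed
  then show ?thesis by (simp add: circles_image image_image cong: image_cong)
qed

lemma inj_on_fibre: "inj_on (\<lambda>a. {x \<in> X. f x = a}) (f ` X)"
  by (rule inj_onI) blast

text \<open>
  All strands run straight around the annulus, and each closes up after one turn.
\<close>
lemma circles_no_turnbacks:
  assumes w: "is_braid_word n w" and S: "turnbacks w I = {}"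
  shows "card (nontrivial_circles n w I) = n" "nontrivial_circles n w I = circles n w I"
proof -
  let ?N = "length w"
  let ?fib = "\<lambda>a. {x \<in> nodes n w. fst x = a}"
  have up: "((p, l), (p, 0)) \<in> connected_by n w I" if "l \<le> ?N" "p \<in> {1..n}" for p l
    using that
  proof (induction l)
    case 0
    show ?case by (rule conn_refl)
  next
    case (Suc l)
    then have "((p, l), (p, Suc l)) \<in> connected_by n w I"
      using S by (intro conn_straight) auto
    with Suc show ?case by (meson Suc_leD conn_sym conn_trans)
  qed
  have img: "fst ` nodes n w = {1..n}" by (force simp: nodes_def)
  have circ: "circles n w I = ?fib ` {1..n}"
    unfolding img[symmetric]
  proof (rule circles_eq_fibres[OF w])
    fix x y assume "(x, y) \<in> resolution_arcs n w I"
    then show "fst x = fst y" using S by (cases rule: resolution_arcs_cases) auto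
  next
    fix x y assume "x \<in> nodes n w" "y \<in> nodes n w" and eq: "fst x = fst y"
    then have "(x, (fst y, 0)) \<in> connected_by n w I" "(y, (fst y, 0)) \<in> connected_by n w I"
      using up[of "snd x" "fst x"] up[of "snd y" "fst y"] by (auto simp: nodes_def)
    then show "(x, y) \<in> connected_by n w I" by (blast intro: conn_trans conn_sym)
  qed
  have count: "node_count (?fib p) 0 n = 1" if "p \<in> {1..n}" for p
  proof -
    have "{q \<in> {1..n}. (q, 0) \<in> ?fib p} = {p}" using that by (auto simp: nodes_def)
    then show ?thesis by (simp add: node_count_card)
  qed
  have "odd (node_count C 0 n)" if "C \<in> circles n w I" for C
    using that count unfolding circ by auto
  then show nt: "nontrivial_circles n w I = circles n w I"
    unfolding nontrivial_circles_eq[OF w le0] by blast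
  show "card (nontrivial_circles n w I) = n"
    unfolding nt circ using inj_on_fibre[of "nodes n w" fst] by (simp add: img card_image)
qed

section \<open>Resolutions with turnbacks\<close>

text \<open>
  A ray lies in a segment between two cyclically consecutive turnbacks. These are the positions
  of the cup at which the segment starts and of the cap at which it ends.
\<close>
definition left_turn :: "braid_word \<Rightarrow> nat set \<Rightarrow> nat \<Rightarrow> nat" where
  "left_turn w I l = fst (w ! prev_in (turnbacks w I) l)"

definition right_turn :: "braid_word \<Rightarrow> nat set \<Rightarrow> nat \<Rightarrow> nat" where
  "right_turn w I l = fst (w ! next_in (turnbacks w I) l)"

text \<open>
  The segments, named by the turnback at which they start, that end in the same position and
  hence contain a trivial circle.
\<close>
definition loops :: "braid_word \<Rightarrow> nat set \<Rightarrow> nat set" where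
  "loops w I = {c \<in> turnbacks w I. fst (w ! c) = fst (w ! next_in (turnbacks w I) (Suc c))}"

text \<open>
  The position of the \<open>a\<close>-th of the \<open>n - 2\<close> strands that pass a turnback at \<open>i\<close>, which catches
  the positions \<open>i\<close> and \<open>i + 1\<close>.
\<close>
definition through :: "nat \<Rightarrow> nat \<Rightarrow> nat" where
  "through i a = (if a < i then a else a + 2)"

context
  fixes n :: nat and w :: braid_word and I :: "nat set"
  assumes w: "is_braid_word n w" and turnbacks_nonempty: "turnbacks w I \<noteq> {}"
begin

lemma left_turn_bounds: "1 \<le> left_turn w I l" "left_turn w I l < n"
  using turnback_bounds[OF w prev_in_mem[OF finite_turnbacks turnbacks_nonempty]]
  by (auto simp: left_turn_def)

lemma right_turn_bounds: "1 \<le> right_turn w I l" "right_turn w I l < n"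
  using turnback_bounds[OF w next_in_mem[OF finite_turnbacks turnbacks_nonempty]]
  by (auto simp: right_turn_def)

lemma left_turn_Suc:
  "l \<in> turnbacks w I \<Longrightarrow> left_turn w I (Suc l) = fst (w ! l)"
  "l \<notin> turnbacks w I \<Longrightarrow> left_turn w I (Suc l) = left_turn w I l"
  by (simp_all add: left_turn_def prev_in_Suc_mem finite_turnbacks prev_in_Suc_not_mem)

lemma right_turn_Suc:
  "l \<in> turnbacks w I \<Longrightarrow> right_turn w I l = fst (w ! l)"
  "l \<notin> turnbacks w I \<Longrightarrow> right_turn w I (Suc l) = right_turn w I l"
  by (simp_all add: right_turn_def next_in_self finite_turnbacks next_in_Suc_not_mem)

lemma turn_wrap:
  "left_turn w I (length w) = left_turn w I 0" "right_turn w I (length w) = right_turn w I 0"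
  by (simp_all add: left_turn_def right_turn_def prev_in_wrap[OF turnbacks_subset]
      next_in_wrap[OF turnbacks_subset])

text \<open>
  On every ray of a segment the two strands that leave its initial cup are joined; dually, in
  the next lemma, those that enter its final cap.
\<close>
lemma conn_left_pair:
  assumes "l \<le> length w"
  shows "((left_turn w I l, l), (Suc (left_turn w I l), l)) \<in> connected_by n w I"
  using turnbacks_subset turnbacks_nonempty assms
proof (induction l rule: cyclic_induct)
  case (start c)
  then show ?case using conn_turn[of c w I "Suc c" n] by (simp add: left_turn_Suc)
next
  case (step l)
  have "((p, l), (p, Suc l)) \<in> connected_by n w I" if "p \<in> {1..n}" for p
    using step that by (intro conn_straight) auto
  from this[of "left_turn w I l"] this[of "Suc (left_turn w I l)"] step.IH left_turn_bounds[of l] step.hyps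
  show ?case by (simp add: left_turn_Suc) (metis conn_sym conn_trans)
next
  case wrap
  from conn_wrap[of "left_turn w I 0" n w I] conn_wrap[of "Suc (left_turn w I 0)" n w I] wrap
    left_turn_bounds[of 0]
  show ?case by (simp add: turn_wrap) (metis conn_sym conn_trans)
qed

lemma conn_right_pair:
  assumes "l \<le> length w"
  shows "((right_turn w I l, l), (Suc (right_turn w I l), l)) \<in> connected_by n w I"
  using turnbacks_subset turnbacks_nonempty assms
proof (induction l rule: cyclic_induct_backward)
  case (start c)
  then show ?case using conn_turn[of c w I c n] by (simp add: right_turn_Suc)
next
  case (step l)
  have "((p, l), (p, Suc l)) \<in> connected_by n w I" if "p \<in> {1..n}" for p
    using step that by (intro conn_straight) auto
  from this[of "right_turn w I l"] this[of "Suc (right_turn w I l)"] step.IH right_turn_bounds[of l] step.hyps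
  show ?case by (simp add: right_turn_Suc) (metis conn_sym conn_trans)
next
  case wrap
  from conn_wrap[of "right_turn w I 0" n w I] conn_wrap[of "Suc (right_turn w I 0)" n w I] wrap
    right_turn_bounds[of 0]
  show ?case by (simp add: turn_wrap) (metis conn_sym conn_trans)
qed

lemma conn_segment_start:
  assumes "l \<le> length w" "p \<in> {1..n}"
  shows "((p, l), (p, Suc (prev_in (turnbacks w I) l))) \<in> connected_by n w I"
  using turnbacks_subset turnbacks_nonempty assms(1)
proof (induction l rule: cyclic_induct)
  case (start c)
  then show ?case by (simp add: prev_in_Suc_mem finite_turnbacks conn_refl)
next
  case (step l)
  have "((p, l), (p, Suc l)) \<in> connected_by n w I"
    using step assms(2) by (intro conn_straight) auto
  with step show ?case by (simp add: prev_in_Suc_not_mem) (metis conn_sym conn_trans)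
next
  case wrap
  with conn_wrap[OF assms(2), of w I] show ?case
    by (simp add: prev_in_wrap[OF turnbacks_subset]) (metis conn_sym conn_trans)
qed

text \<open>
  The cup before the ray and the cap after it join two disjoint pairs of nodes of the ray. A
  circle through one such pair uses two nodes of the ray more than its parity requires, and a
  circle through both pairs uses four more. As there are only \<open>n\<close> nodes and every nontrivial
  circle needs one, at least four are lost.
\<close>
lemma nontrivial_circles_far_turns:
  assumes l: "l \<le> length w"
    and far: "Suc (left_turn w I l) < right_turn w I l \<or> Suc (right_turn w I l) < left_turn w I l"
  shows "card (nontrivial_circles n w I) + 4 \<le> n"
proof -
  let ?C = "\<lambda>p. connected_by n w I `` {(p, l)}"
  let ?L = "left_turn w I l" and ?R = "right_turn w I l"
  note bounds = left_turn_bounds[of l] right_turn_bounds[of l]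
  have circ: "?C ?L \<in> circles n w I" "?C ?R \<in> circles n w I"
    using bounds l by (auto simp: circles_image nodes_def)
  have nt: "nontrivial_circles n w I = {C \<in> circles n w I. odd (node_count C l n)}"
    by (rule nontrivial_circles_eq[OF w l])
  \<comment> \<open>The two pairs are disjoint, so they also count separately when both lie on the same circle.\<close>
  have two: "2 * of_bool (C = ?C ?L) + 2 * of_bool (C = ?C ?R) \<le> node_count C l n" for C
  proof -
    have L: "?L \<in> {p \<in> {1..n}. (p, l) \<in> ?C ?L}" "Suc ?L \<in> {p \<in> {1..n}. (p, l) \<in> ?C ?L}"
      and R: "?R \<in> {p \<in> {1..n}. (p, l) \<in> ?C ?R}" "Suc ?R \<in> {p \<in> {1..n}. (p, l) \<in> ?C ?R}"
      using bounds conn_left_pair[OF l] conn_right_pair[OF l] by (auto simp: conn_refl)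
    let ?A = "(if C = ?C ?L then {?L, Suc ?L} else {}) \<union> (if C = ?C ?R then {?R, Suc ?R} else {})"
    have "?A \<subseteq> {p \<in> {1..n}. (p, l) \<in> C}" using L R by (auto split: if_splits)
    then have "card ?A \<le> card {p \<in> {1..n}. (p, l) \<in> C}" by (intro card_mono) auto
    moreover have "card ?A = 2 * of_bool (C = ?C ?L) + 2 * of_bool (C = ?C ?R)"
      using far by (subst card_Un_disjoint) auto
    ultimately show ?thesis by (simp only: node_count_card)
  qed
  \<comment> \<open>The lower bound just proved is even, so it is not attained on a circle that meets the ray an odd number of times.\<close>
  have "of_bool (odd (node_count C l n)) + (2 * of_bool (C = ?C ?L) + 2 * of_bool (C = ?C ?R))
      \<le> node_count C l n" for C
    using two[of C] by (cases "C = ?C ?L"; cases "C = ?C ?R") (auto elim!: oddE)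
  then have "(\<Sum>C\<in>circles n w I. of_bool (odd (node_count C l n))
        + (2 * of_bool (C = ?C ?L) + 2 * of_bool (C = ?C ?R)))
      \<le> (\<Sum>C\<in>circles n w I. node_count C l n)"
    by (rule sum_mono)
  then have "(\<Sum>C\<in>circles n w I. of_bool (odd (node_count C l n))
        + (2 * of_bool (C = ?C ?L) + 2 * of_bool (C = ?C ?R))) \<le> n"
    by (simp only: sum_node_count_circles[OF l])
  moreover have "(\<Sum>C\<in>circles n w I. of_bool (C = X) :: nat) = 1" if "X \<in> circles n w I" for X
  proof -
    have "circles n w I \<inter> {C. C = X} = {X}" using that by blast
    then show ?thesis by (simp add: finite_circles)
  qed
  moreover have "(\<Sum>C\<in>circles n w I. of_bool (odd (node_count C l n)) :: nat)
      = card (nontrivial_circles n w I)"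
  proof -
    have "circles n w I \<inter> {C. odd (node_count C l n)} = nontrivial_circles n w I"
      by (auto simp: nt)
    then show ?thesis by (simp add: finite_circles)
  qed
  ultimately show ?thesis
    using circ by (simp only: sum.distrib sum_distrib_left[symmetric])
qed

context
  assumes near: "\<And>l. l \<le> length w \<Longrightarrow> left_turn w I l \<le> Suc (right_turn w I l) \<and> right_turn w I l \<le> Suc (left_turn w I l)"
begin

text \<open>
  The complete invariant of the components. In a segment with equal cup and cap positions, the
  two caught strands form a trivial circle, named by the turnback at its start. In a segment
  whose positions differ by one, the three strands around them form one zigzag, which continues
  the through strand numbered by the smaller position. All other strands are through strands,
  numbered from below.
\<close>
fun strand_label :: "nat \<times> nat \<Rightarrow> nat + nat" where
  "strand_label (p, l) =
     (let L = left_turn w I l; R = right_turn w I l in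
      if L = R then
        if p < L then Inl p else if p \<le> Suc L then Inr (prev_in (turnbacks w I) l) else Inl (p - 2)
      else if p < min L R then Inl p else if p \<le> min L R + 2 then Inl (min L R) else Inl (p - 2))"

declare strand_label.simps [simp del]

text \<open>
  Off the turnback at the start of its segment, the label of a node is its number among the
  strands that pass this turnback; the same holds at the end of the segment. As the numbering at
  a turnback is the same on both sides, labels are constant along the strands that pass it.
\<close>
lemma strand_label_off_left:
  assumes "l \<le> length w" "p \<noteq> left_turn w I l" "p \<noteq> Suc (left_turn w I l)"
  shows "strand_label (p, l) = Inl (if p < left_turn w I l then p else p - 2)"
  using near[OF assms(1)] assms(2,3) unfolding strand_label.simps Let_def min_def by auto

lemma strand_label_off_right:
  assumes "l \<le> length w" "p \<noteq> right_turn w I l" "p \<noteq> Suc (right_turn w I l)"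
  shows "strand_label (p, l) = Inl (if p < right_turn w I l then p else p - 2)"
  using near[OF assms(1)] assms(2,3) unfolding strand_label.simps Let_def min_def by auto

lemma strand_label_pairs:
  assumes "l \<le> length w"
  shows "strand_label (left_turn w I l, l) = strand_label (Suc (left_turn w I l), l)"
    and "strand_label (right_turn w I l, l) = strand_label (Suc (right_turn w I l), l)"
  using near[OF assms(1)] unfolding strand_label.simps Let_def min_def by auto

lemma strand_label_arc:
  assumes "(x, y) \<in> resolution_arcs n w I"
  shows "strand_label x = strand_label y"
  using assms
proof (cases rule: resolution_arcs_cases)
  case (straight p l)
  show ?thesis
  proof (cases "l \<in> turnbacks w I")
    case True
    then show ?thesis
      using straight strand_label_off_left[of "Suc l" p] strand_label_off_right[of l p]
      by (simp add: left_turn_Suc right_turn_Suc)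
  next
    case False
    then show ?thesis unfolding straight strand_label.simps
      by (simp only: left_turn_Suc(2)[OF False] right_turn_Suc(2)[OF False] prev_in_Suc_not_mem[OF False])
  qed
next
  case (turn l m)
  have "l < length w" using turn turnbacks_subset by auto
  then show ?thesis
    using turn strand_label_pairs(1)[of "Suc l"] strand_label_pairs(2)[of l]
    by (auto simp: left_turn_Suc right_turn_Suc)
next
  case (wrap p)
  then show ?thesis unfolding wrap strand_label.simps
    by (simp only: turn_wrap prev_in_wrap[OF turnbacks_subset])
qed

lemma through_range:
  assumes "a \<in> {1..n - 2}"
  shows "through (left_turn w I l) a \<in> {1..n}" "through (right_turn w I l) a \<in> {1..n}"
  using assms left_turn_bounds[of l] right_turn_bounds[of l] by (auto simp: through_def)

text \<open>
  Within a segment, the \<open>a\<close>-th strand past the initial cup and the \<open>a\<close>-th strand past the final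
  cap either coincide or are the two ends of the zigzag.
\<close>
lemma conn_through_left_right:
  assumes l: "l \<le> length w"
  shows "((through (left_turn w I l) a, l), (through (right_turn w I l) a, l)) \<in> connected_by n w I"
proof -
  let ?L = "left_turn w I l" and ?R = "right_turn w I l"
  consider "?L = ?R" | "?R = Suc ?L" | "?L = Suc ?R"
    using near[OF l] by linarith
  then show ?thesis
  proof cases
    case 1
    then show ?thesis by (simp add: conn_refl)
  next
    case 2
    show ?thesis
    proof (cases "a = ?L")
      case True
      have "((?L, l), (Suc (Suc ?L), l)) \<in> connected_by n w I"
        using conn_left_pair[OF l] conn_right_pair[OF l] 2 by (auto intro: conn_trans)
      then show ?thesis using True 2 by (simp add: through_def conn_sym)
    qed (use 2 in \<open>auto simp: through_def conn_refl\<close>)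
  next
    case 3
    show ?thesis
    proof (cases "a = ?R")
      case True
      have "((?R, l), (Suc (Suc ?R), l)) \<in> connected_by n w I"
        using conn_left_pair[OF l] conn_right_pair[OF l] 3 by (auto intro: conn_trans)
      then show ?thesis using True 3 by (simp add: through_def)
    qed (use 3 in \<open>auto simp: through_def conn_refl\<close>)
  qed
qed

lemma conn_through_start:
  assumes "l \<le> length w" and a: "a \<in> {1..n - 2}"
  shows "((through (left_turn w I l) a, l), (through (left_turn w I 0) a, 0)) \<in> connected_by n w I"
  using assms(1)
proof (induction l)
  case 0
  show ?case by (rule conn_refl)
next
  case (Suc l)
  then have IH: "((through (left_turn w I l) a, l), (through (left_turn w I 0) a, 0)) \<in> connected_by n w I"
    by simp
  show ?case
  proof (cases "l \<in> turnbacks w I")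
    case True
    have "((through (right_turn w I l) a, l), (through (right_turn w I l) a, Suc l)) \<in> connected_by n w I"
      using Suc.prems True through_range(2)[OF a, of l]
      by (intro conn_straight) (auto simp: right_turn_Suc through_def)
    then show ?thesis
      using IH conn_through_left_right[of l a] Suc.prems True
      by (simp add: left_turn_Suc right_turn_Suc) (metis conn_sym conn_trans)
  next
    case False
    then have "((through (left_turn w I l) a, l), (through (left_turn w I l) a, Suc l)) \<in> connected_by n w I"
      using Suc.prems through_range(1)[OF a, of l] by (intro conn_straight) auto
    then show ?thesis
      using IH False by (simp add: left_turn_Suc) (metis conn_sym conn_trans)
  qed
qed

lemma strand_label_through:
  assumes "l \<le> length w"
  shows "strand_label (through (left_turn w I l) a, l) = Inl a"
  using assms strand_label_off_left[of l "through (left_turn w I l) a"] by (auto simp: through_def)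

lemma strand_label_Inl:
  assumes l: "l \<le> length w" and p: "p \<in> {1..n}" and a: "strand_label (p, l) = Inl a"
  shows "a \<in> {1..n - 2}"
    and "((p, l), (through (left_turn w I l) a, l)) \<in> connected_by n w I"
proof -
  let ?L = "left_turn w I l" and ?R = "right_turn w I l"
  note bounds = left_turn_bounds[of l] right_turn_bounds[of l]
  show "a \<in> {1..n - 2}"
    using a near[OF l] bounds p unfolding strand_label.simps Let_def min_def
    by (auto split: if_splits)
  show "((p, l), (through ?L a, l)) \<in> connected_by n w I"
  proof (cases "p = ?L \<or> p = Suc ?L")
    case False
    then have "through ?L a = p"
      using a strand_label_off_left[OF l, of p] bounds by (auto simp: through_def split: if_splits)
    then show ?thesis by (simp add: conn_refl)
  next
    case True
    then have p_L: "((p, l), (?L, l)) \<in> connected_by n w I"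
      using conn_left_pair[OF l] by (auto intro: conn_refl conn_sym)
    have "?L \<noteq> ?R"
      using a True unfolding strand_label.simps Let_def by (auto split: if_splits)
    then consider "?R = Suc ?L" | "?L = Suc ?R" using near[OF l] by linarith
    then show ?thesis
    proof cases
      case 1
      then have "a = ?L" using a True unfolding strand_label.simps Let_def min_def by auto
      moreover have "((?L, l), (Suc (Suc ?L), l)) \<in> connected_by n w I"
        using conn_left_pair[OF l] conn_right_pair[OF l] 1 by (auto intro: conn_trans)
      ultimately show ?thesis using p_L by (auto simp: through_def intro: conn_trans)
    next
      case 2
      then have "a = ?R" using a True unfolding strand_label.simps Let_def min_def by auto
      moreover have "((?L, l), (?R, l)) \<in> connected_by n w I"
        using conn_right_pair[OF l] 2 by (auto intro: conn_sym)
      ultimately show ?thesis using p_L 2 by (auto simp: through_def intro: conn_trans)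
    qed
  qed
qed

lemma strand_label_Inr:
  assumes "strand_label (p, l) = Inr c"
  shows "left_turn w I l = right_turn w I l" "p = left_turn w I l \<or> p = Suc (left_turn w I l)"
    "c = prev_in (turnbacks w I) l"
  using assms unfolding strand_label.simps Let_def by (auto split: if_splits)

text \<open>
  Through strands are followed back to ray \<open>0\<close>, trivial circles to the cup at the start of their
  segment.
\<close>
lemma strand_label_eq_imp_conn:
  assumes "x \<in> nodes n w" "y \<in> nodes n w" and eq: "strand_label x = strand_label y"
  shows "(x, y) \<in> connected_by n w I"
proof -
  obtain p l q m where x: "x = (p, l)" and y: "y = (q, m)" by fastforce
  with assms have pq: "p \<in> {1..n}" "q \<in> {1..n}" and lm: "l \<le> length w" "m \<le> length w"
    by (auto simp: nodes_def)
  show ?thesis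
  proof (cases "strand_label x")
    case (Inl a)
    then have "strand_label (p, l) = Inl a" "strand_label (q, m) = Inl a" using eq x y by auto
    note X = strand_label_Inl[OF lm(1) pq(1) this(1)] and Y = strand_label_Inl[OF lm(2) pq(2) this(2)]
    show ?thesis
      unfolding x y
      using X(2) Y(2) conn_through_start[OF lm(1) X(1)] conn_through_start[OF lm(2) X(1)]
      by (metis conn_sym conn_trans)
  next
    case (Inr c)
    have *: "((r, k), (fst (w ! c), Suc c)) \<in> connected_by n w I"
      if "strand_label (r, k) = Inr c" "k \<le> length w" for r k
    proof -
      note r = strand_label_Inr[OF that(1)]
      have L: "left_turn w I k = fst (w ! c)" by (simp add: left_turn_def r(3))
      have "((r, k), (left_turn w I k, k)) \<in> connected_by n w I"
        using r(2) conn_left_pair[OF that(2)] by (auto intro: conn_refl conn_sym)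
      moreover have "((left_turn w I k, k), (left_turn w I k, Suc c)) \<in> connected_by n w I"
        using conn_segment_start[OF that(2), of "left_turn w I k"] left_turn_bounds[of k]
        by (simp add: r(3))
      ultimately show ?thesis using L conn_trans by metis
    qed
    show ?thesis
      using *[of p l] *[of q m] Inr eq lm unfolding x y by (metis conn_sym conn_trans)
  qed
qed

lemma strand_label_image:
  "strand_label ` nodes n w = Inl ` {1..n - 2} \<union> Inr ` loops w I"
proof (intro subset_antisym subsetI)
  fix a assume "a \<in> strand_label ` nodes n w"
  then obtain p l where pl: "p \<in> {1..n}" "l \<le> length w" "a = strand_label (p, l)"
    by (auto simp: nodes_def)
  show "a \<in> Inl ` {1..n - 2} \<union> Inr ` loops w I"
  proof (cases a)
    case (Inl b)
    then show ?thesis using strand_label_Inl(1)[OF pl(2,1)] pl(3) by auto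
  next
    case (Inr c)
    with pl have "strand_label (p, l) = Inr c" by simp
    note r = strand_label_Inr[OF this]
    have "c \<in> turnbacks w I"
      unfolding r(3) by (rule prev_in_mem[OF finite_turnbacks turnbacks_nonempty])
    moreover have "fst (w ! c) = fst (w ! next_in (turnbacks w I) (Suc c))"
      using r(1) next_in_prev_in[OF turnbacks_subset turnbacks_nonempty pl(2)]
      unfolding left_turn_def right_turn_def r(3) by simp
    ultimately show ?thesis using Inr by (simp add: loops_def)
  qed
next
  fix a assume "a \<in> Inl ` {1..n - 2} \<union> Inr ` loops w I"
  then consider b where "b \<in> {1..n - 2}" "a = Inl b" | c where "c \<in> loops w I" "a = Inr c" by blast
  then show "a \<in> strand_label ` nodes n w"
  proof cases
    case 1
    have "a = strand_label (through (left_turn w I 0) b, 0)" using strand_label_through[of 0 b] 1 by simp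
    moreover have "(through (left_turn w I 0) b, 0) \<in> nodes n w"
      using through_range(1)[OF 1(1), of 0] by (simp add: nodes_def)
    ultimately show ?thesis by blast
  next
    case 2
    then have c: "c \<in> turnbacks w I" and loop: "left_turn w I (Suc c) = right_turn w I (Suc c)"
      by (simp_all add: loops_def left_turn_Suc right_turn_def)
    have "a = strand_label (fst (w ! c), Suc c)"
      using 2 c loop[symmetric]
      by (simp add: strand_label.simps left_turn_Suc prev_in_Suc_mem finite_turnbacks)
    moreover have "(fst (w ! c), Suc c) \<in> nodes n w"
      using turnback_bounds[OF w c] by (auto simp: nodes_def)
    ultimately show ?thesis by blast
  qed
qed

lemma node_count_fibre:
  "node_count {x \<in> nodes n w. strand_label x = a} 0 n = card {p \<in> {1..n}. strand_label (p, 0) = a}"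
  unfolding node_count_card by (rule arg_cong[where f = card]) (auto simp: nodes_def)

text \<open>
  A through strand meets a ray once, or three times where it is the zigzag.
\<close>
lemma odd_node_count_Inl:
  assumes "a \<in> {1..n - 2}"
  shows "odd (node_count {x \<in> nodes n w. strand_label x = Inl a} 0 n)"
proof -
  let ?L = "left_turn w I 0" and ?R = "right_turn w I 0"
  note bounds = left_turn_bounds[of 0] right_turn_bounds[of 0]
  have eq: "{p \<in> {1..n}. strand_label (p, 0) = Inl a} =
     (if ?L \<noteq> ?R \<and> a = min ?L ?R then {a, Suc a, Suc (Suc a)} else {through ?L a})"
    using near[of 0] bounds assms unfolding strand_label.simps Let_def min_def through_def
    by (auto split: if_splits)
  show ?thesis unfolding node_count_fibre eq by simp
qed

lemma even_node_count_Inr: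
  "even (node_count {x \<in> nodes n w. strand_label x = Inr c} 0 n)"
proof -
  let ?L = "left_turn w I 0" and ?R = "right_turn w I 0"
  note bounds = left_turn_bounds[of 0] right_turn_bounds[of 0]
  have eq: "{p \<in> {1..n}. strand_label (p, 0) = Inr c} =
     (if ?L = ?R \<and> c = prev_in (turnbacks w I) 0 then {?L, Suc ?L} else {})"
    using bounds unfolding strand_label.simps Let_def by (auto split: if_splits)
  show ?thesis unfolding node_count_fibre eq by simp
qed

lemma circles_near_turns:
  "card (nontrivial_circles n w I) = n - 2"
  "card (circles n w I - nontrivial_circles n w I) = card (loops w I)"
proof -
  let ?fib = "\<lambda>a. {x \<in> nodes n w. strand_label x = a}"
  have circ: "circles n w I = ?fib ` (Inl ` {1..n - 2} \<union> Inr ` loops w I)"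
    unfolding strand_label_image[symmetric]
    by (rule circles_eq_fibres[OF w strand_label_arc strand_label_eq_imp_conn])
  have inj: "inj_on ?fib (Inl ` {1..n - 2} \<union> Inr ` loops w I)"
    unfolding strand_label_image[symmetric] by (rule inj_on_fibre)
  define F G where "F = ?fib ` Inl ` {1..n - 2}" and "G = ?fib ` Inr ` loops w I"
  have F: "\<And>C. C \<in> F \<Longrightarrow> odd (node_count C 0 n)"
    unfolding F_def using odd_node_count_Inl by blast
  have G: "\<And>C. C \<in> G \<Longrightarrow> even (node_count C 0 n)"
    unfolding G_def using even_node_count_Inr by blast
  have FG: "circles n w I = F \<union> G" unfolding circ F_def G_def by (rule image_Un)
  have nt: "nontrivial_circles n w I = F" "circles n w I - nontrivial_circles n w I = G"
    unfolding nontrivial_circles_eq[OF w le0] FG using F G by blast+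
  have "card F = card (Inl ` {1..n - 2} :: (nat + nat) set)"
    unfolding F_def by (rule card_image[OF inj_on_subset[OF inj]]) (rule Un_upper1)
  then show "card (nontrivial_circles n w I) = n - 2"
    unfolding nt by (simp add: card_image)
  have "card G = card (Inr ` loops w I :: (nat + nat) set)"
    unfolding G_def by (rule card_image[OF inj_on_subset[OF inj]]) (rule Un_upper2)
  then show "card (circles n w I - nontrivial_circles n w I) = card (loops w I)"
    unfolding nt(2) by (simp add: card_image)
qed

end
end

section \<open>Counting generators in the second highest winding degree\<close>

lemma qt_monom_add: "qt_monom (a + b) 0 = qt_monom a 0 * qt_monom b 0"
  by (simp add: qt_monom_mult)

lemma qt_monom_sum: "qt_monom (\<Sum>c\<in>A. f c) 0 = (\<Prod>c\<in>A. qt_monom (f c) 0)"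
  by (induction A rule: infinite_finite_induct) (simp_all add: qt_monom_0 qt_monom_add)

lemma qt_monom_power: "qt_monom a 0 ^ k = qt_monom (int k * a) 0"
  by (induction k) (simp_all add: qt_monom_0 qt_monom_mult algebra_simps)

text \<open>
  Expanding the power over the choice of \<open>v\<^sub>+\<close> or \<open>v\<^sub>-\<close> on each circle.
\<close>
lemma sum_signings:
  assumes "finite T"
  shows "(\<Sum>P\<in>Pow T. qt_monom (\<Sum>C\<in>T. v_sign P C) 0) = (qt_monom 1 0 + qt_monom (- 1) 0) ^ card T"
proof -
  have "qt_monom (\<Sum>C\<in>T. v_sign P C) 0
      = (\<Prod>C\<in>P. qt_monom 1 0) * (\<Prod>C\<in>T - P. qt_monom (- 1) 0)" if "P \<in> Pow T" for P
  proof -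
    have "(\<Prod>C\<in>T. qt_monom (v_sign P C) 0)
        = (\<Prod>C\<in>T - P. qt_monom (v_sign P C) 0) * (\<Prod>C\<in>P. qt_monom (v_sign P C) 0)"
      using that assms by (intro prod.subset_diff) auto
    then show ?thesis by (simp add: qt_monom_sum v_sign_def mult.commute)
  qed
  then show ?thesis
    using prod_add[OF assms, of "\<lambda>_. qt_monom 1 0" "\<lambda>_. qt_monom (- 1) 0"] by simp
qed

text \<open>
  The signs on the nontrivial circles \<open>A\<close> are constrained by the \<open>k\<close>-grading and contribute
  \<open>q\<^sup>k\<close>, while those on the trivial circles are free.
\<close>
lemma sum_enhancements:
  assumes "finite X" "A \<subseteq> X"
  shows "(\<Sum>P | P \<subseteq> X \<and> (\<Sum>C\<in>A. v_sign P C) = k. qt_monom (\<Sum>C\<in>X. v_sign P C) m) =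
    of_nat (card {P. P \<subseteq> A \<and> (\<Sum>C\<in>A. v_sign P C) = k}) * qt_monom k m *
    (qt_monom 1 0 + qt_monom (- 1) 0) ^ card (X - A)"
proof -
  let ?T = "X - A"
  let ?K = "{P. P \<subseteq> A \<and> (\<Sum>C\<in>A. v_sign P C) = k}"
  have fin: "finite A" "finite ?T" using assms finite_subset by auto
  have restrict: "(\<Sum>C\<in>Y. v_sign (P \<inter> Y) C) = (\<Sum>C\<in>Y. v_sign P C)" for P Y
    by (intro sum.cong) (auto simp: v_sign_def)
  have "(\<Sum>P | P \<subseteq> X \<and> (\<Sum>C\<in>A. v_sign P C) = k. qt_monom (\<Sum>C\<in>X. v_sign P C) m)
      = (\<Sum>(P, Q)\<in>?K \<times> Pow ?T. qt_monom k m * qt_monom (\<Sum>C\<in>?T. v_sign Q C) 0)"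
  proof (rule sum.reindex_bij_witness[where i = "\<lambda>(P, Q). P \<union> Q" and j = "\<lambda>P. (P \<inter> A, P \<inter> ?T)"])
    fix P assume P: "P \<in> {P. P \<subseteq> X \<and> (\<Sum>C\<in>A. v_sign P C) = k}"
    then show "(case (P \<inter> A, P \<inter> ?T) of (P, Q) \<Rightarrow> P \<union> Q) = P" by auto
    show "(P \<inter> A, P \<inter> ?T) \<in> ?K \<times> Pow ?T" using P restrict[of P A] by auto
    have "(\<Sum>C\<in>X. v_sign P C) = (\<Sum>C\<in>?T. v_sign P C) + (\<Sum>C\<in>A. v_sign P C)"
      using assms by (intro sum.subset_diff) auto
    then show "(case (P \<inter> A, P \<inter> ?T) of (P, Q) \<Rightarrow> qt_monom k m * qt_monom (\<Sum>C\<in>?T. v_sign Q C) 0)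
        = qt_monom (\<Sum>C\<in>X. v_sign P C) m"
      using P restrict[of P ?T] by (simp add: qt_monom_mult add.commute)
  next
    fix PQ assume PQ: "PQ \<in> ?K \<times> Pow ?T"
    obtain P Q where eq: "PQ = (P, Q)" by fastforce
    have sub: "P \<subseteq> A" "Q \<subseteq> ?T" using PQ eq by auto
    then have int: "(P \<union> Q) \<inter> A = P" "(P \<union> Q) \<inter> ?T = Q" by auto
    then show "((case PQ of (P, Q) \<Rightarrow> P \<union> Q) \<inter> A, (case PQ of (P, Q) \<Rightarrow> P \<union> Q) \<inter> ?T) = PQ"
      unfolding eq by simp
    show "(case PQ of (P, Q) \<Rightarrow> P \<union> Q) \<in> {P. P \<subseteq> X \<and> (\<Sum>C\<in>A. v_sign P C) = k}"
      using PQ sub restrict[of "P \<union> Q" A] assms(2) int unfolding eq by auto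
  qed
  also have "\<dots> = (\<Sum>P\<in>?K. \<Sum>Q\<in>Pow ?T. qt_monom k m * qt_monom (\<Sum>C\<in>?T. v_sign Q C) 0)"
    by (rule sum.cartesian_product[symmetric])
  also have "\<dots> = of_nat (card ?K) * qt_monom k m * (qt_monom 1 0 + qt_monom (- 1) 0) ^ card ?T"
    using sum_signings[OF fin(2)] by (simp flip: sum_distrib_left)
  finally show ?thesis .
qed

lemma card_signings:
  assumes A: "finite A"
  shows "int (card A) < k \<Longrightarrow> card {P. P \<subseteq> A \<and> (\<Sum>C\<in>A. v_sign P C) = k} = 0"
    and "int (card A) = k \<Longrightarrow> card {P. P \<subseteq> A \<and> (\<Sum>C\<in>A. v_sign P C) = k} = 1"
    and "int (card A) = k + 2 \<Longrightarrow> 1 \<le> card A \<Longrightarrow>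
      card {P. P \<subseteq> A \<and> (\<Sum>C\<in>A. v_sign P C) = k} = card A"
proof -
  have signed: "(\<Sum>C\<in>A. v_sign P C) = 2 * int (card P) - int (card A)" if "P \<subseteq> A" for P
  proof -
    have "(\<Sum>C\<in>A. v_sign P C) = (\<Sum>C\<in>A - P. v_sign P C) + (\<Sum>C\<in>P. v_sign P C)"
      using A that by (intro sum.subset_diff) auto
    moreover have "card P \<le> card A" using A that by (rule card_mono)
    ultimately show ?thesis
      using A that by (simp add: v_sign_def card_Diff_subset finite_subset of_nat_diff)
  qed
  have choose: "card {P. P \<subseteq> A \<and> (\<Sum>C\<in>A. v_sign P C) = k} = card A choose j"
    if "2 * int j = k + int (card A)" for k j
  proof -
    have "{P. P \<subseteq> A \<and> (\<Sum>C\<in>A. v_sign P C) = k} = {P. P \<subseteq> A \<and> card P = j}"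
      using signed that by auto
    then show ?thesis using n_subsets[OF A] by simp
  qed
  show "card {P. P \<subseteq> A \<and> (\<Sum>C\<in>A. v_sign P C) = k} = 0" if "int (card A) < k"
  proof -
    have "(\<Sum>C\<in>A. v_sign P C) \<noteq> k" if "P \<subseteq> A" for P
      using signed[OF that] card_mono[OF A that] \<open>int (card A) < k\<close> by linarith
    then have "{P. P \<subseteq> A \<and> (\<Sum>C\<in>A. v_sign P C) = k} = {}" by blast
    then show ?thesis by (simp only: card.empty)
  qed
  show "card {P. P \<subseteq> A \<and> (\<Sum>C\<in>A. v_sign P C) = k} = 1" if "int (card A) = k"
    using choose[of "card A" k] that by simp
  show "card {P. P \<subseteq> A \<and> (\<Sum>C\<in>A. v_sign P C) = k} = card A"
    if "int (card A) = k + 2" "1 \<le> card A"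
  proof -
    have "2 * int (card A - 1) = k + int (card A)" using that by (simp add: of_nat_diff)
    then show ?thesis
      using choose[of "card A - 1" k] that(2) binomial_symmetric[of "card A - 1" "card A"] by simp
  qed
qed

text \<open>
  The comparison for one resolution. The three cases are those of the introduction: no turnback,
  consecutive turnbacks always in equal or adjacent positions, and some consecutive turnbacks
  further apart. The power of \<open>q\<close> on the left compensates the factor \<open>x\<close> in each pairing of the
  rank one matrices.
\<close>
lemma resolution_weight:
  fixes n :: nat and w :: braid_word
  defines "k \<equiv> int n - 2"
  assumes n: "1 \<le> n" and w: "is_braid_word n w"
  shows "qt_monom (int (card (turnbacks w I))) 0 *
      (\<Sum>P | P \<subseteq> circles n w I \<and> (\<Sum>C\<in>nontrivial_circles n w I. v_sign P C) = k.
        qt_monom (\<Sum>C\<in>circles n w I. v_sign P C) k)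
    = qt_monom k k * tl_weight (qt_monom 1 0) (qt_monom (- 1) 0) n w (turnbacks w I)"
proof -
  let ?S = "turnbacks w I"
  let ?X = "circles n w I" and ?A = "nontrivial_circles n w I"
  let ?x = "qt_monom 1 0" and ?y = "qt_monom (- 1) 0"
  let ?count = "card {P. P \<subseteq> ?A \<and> (\<Sum>C\<in>?A. v_sign P C) = k}"
  let ?i = "\<lambda>c. fst (w ! c)" and ?j = "\<lambda>c. fst (w ! next_in ?S (Suc c))"
  have sub: "?A \<subseteq> ?X" by (auto simp: nontrivial_circles_def)
  have fin: "finite ?A" using sub finite_circles by (rule finite_subset)
  note enh = sum_enhancements[OF finite_circles sub, of k k]
  show ?thesis
  proof (cases "?S = {}")
    case True
    note flat = circles_no_turnbacks[OF w True]
    have "?count = n" using card_signings(3)[OF fin, of k] flat(1) n by (simp add: k_def)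
    then show ?thesis unfolding enh by (simp add: True flat(2) tl_weight_def qt_monom_0)
  next
    case False
    then have "2 \<le> n" using turnback_bounds[OF w] by fastforce
    have power: "(\<Prod>c\<in>?S. ?x * f c) = qt_monom (int (card ?S)) 0 * (\<Prod>c\<in>?S. f c)" for f
      by (simp add: prod.distrib qt_monom_power)
    show ?thesis
    proof (cases "\<forall>l\<le>length w. left_turn w I l \<le> Suc (right_turn w I l) \<and> right_turn w I l \<le> Suc (left_turn w I l)")
      case near: True
      have circ: "card ?A = n - 2" "card (?X - ?A) = card (loops w I)"
        using circles_near_turns[OF w False] near by blast+
      have "int (card ?A) = k" using circ(1) \<open>2 \<le> n\<close> by (simp add: k_def of_nat_diff)
      then have count: "?count = 1" by (rule card_signings(2)[OF fin])
      have "loop_weight ?x ?y (?i c) (?j c) = (if c \<in> loops w I then ?x + ?y else 1)" if "c \<in> ?S" for c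
      proof -
        have "Suc c \<le> length w" using that turnbacks_subset[of w I] by auto
        then have "?i c \<le> Suc (?j c) \<and> ?j c \<le> Suc (?i c)"
          using near[rule_format, of "Suc c"] that
          by (auto simp: left_turn_def right_turn_def prev_in_Suc_mem finite_turnbacks)
        then show ?thesis using that by (auto simp: loop_weight_def loops_def)
      qed
      then have "(\<Prod>c\<in>?S. loop_weight ?x ?y (?i c) (?j c)) = (\<Prod>c\<in>?S. if c \<in> loops w I then ?x + ?y else 1)"
        by (rule prod.cong[OF refl])
      also have "\<dots> = (\<Prod>c\<in>loops w I. ?x + ?y)"
        using finite_turnbacks[of w I]
        by (subst prod.inter_restrict[symmetric])
          (auto simp: loops_def Int_def intro!: arg_cong2[where f = power] arg_cong[where f = card])
      finally show ?thesis
        unfolding enh circ(2) count using False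
        by (simp add: tl_weight_def power)
    next
      case far: False
      then obtain l where l: "l \<le> length w"
        "Suc (left_turn w I l) < right_turn w I l \<or> Suc (right_turn w I l) < left_turn w I l"
        by (auto simp: not_le)
      then have "int (card ?A) < k"
        using nontrivial_circles_far_turns[OF w False l] by (simp add: k_def)
      then have count: "?count = 0" by (rule card_signings(1)[OF fin])
      let ?c = "prev_in ?S l"
      have c: "?c \<in> ?S" by (rule prev_in_mem[OF finite_turnbacks False])
      have "?x * loop_weight ?x ?y (?i ?c) (?j ?c) = 0"
        using l(2) unfolding left_turn_def right_turn_def
        by (auto simp: next_in_prev_in[OF turnbacks_subset False l(1)] loop_weight_def)
      then have "tl_weight ?x ?y n w ?S = 0"
        using c False finite_turnbacks[of w I] by (auto simp: tl_weight_def intro!: prod_zero)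
      then show ?thesis unfolding enh count by simp
    qed
  qed
qed

text \<open>
  A sign for each factor is a sign by the parity of the number of factors, which is that of the
  total exponent.
\<close>
lemma prod_odd_monomials:
  assumes "finite S" "\<And>c. c \<in> S \<Longrightarrow> odd (f c)"
  shows "(\<Prod>c\<in>S. - qt_monom (f c) 0)
    = of_int (if even (\<Sum>c\<in>S. f c) then 1 else - 1) * qt_monom (\<Sum>c\<in>S. f c) 0"
  using assms
  by (induction S rule: finite_induct) (auto simp: qt_monom_0 qt_monom_add)

text \<open>
  Passing from the set of \<open>1\<close>-resolved crossings to the set of turnbacks complements it at the
  negative crossings, so each set of crossings is the set of turnbacks of exactly one
  resolution.
\<close>
lemma turnbacks_involution:
  assumes "I \<subseteq> {..<length w}"
  shows "turnbacks w (turnbacks w I) = I"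
  using assms by (auto simp: turnbacks_def oriented_at_def)

lemma n_neg_eq: "int (n_neg w) = (\<Sum>c<length w. of_bool (\<not> snd (w ! c)))"
  by (simp add: n_neg_def length_filter_conv_card case_prod_unfold Int_def)

text \<open>
  A positive crossing is a turnback iff it is \<open>1\<close>-resolved, and a negative one iff it is
  \<open>0\<close>-resolved. So the signed number of turnbacks is the homological grading.
\<close>
lemma sum_turnback_signs:
  assumes "I \<subseteq> {..<length w}"
  shows "(\<Sum>c\<in>turnbacks w I. if snd (w ! c) then 1 else - 1) = int (card I) - int (n_neg w)"
proof -
  have "(\<Sum>c\<in>turnbacks w I. if snd (w ! c) then 1 else - 1 :: int)
      = (\<Sum>c<length w. if c \<in> turnbacks w I then if snd (w ! c) then 1 else - 1 else 0)"
    using turnbacks_subset[of w I]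
    by (subst sum.inter_restrict[symmetric]) (auto simp: Int_absorb1)
  also have "\<dots> = (\<Sum>c<length w. of_bool (c \<in> I) - of_bool (\<not> snd (w ! c)))"
    by (intro sum.cong) (auto simp: turnbacks_def oriented_at_def)
  also have "\<dots> = (\<Sum>c<length w. of_bool (c \<in> I)) - int (n_neg w)"
    by (simp only: sum_subtractf n_neg_eq)
  also have "(\<Sum>c<length w. of_bool (c \<in> I) :: int) = int (card I)"
    using assms by (simp add: Int_absorb1)
  finally show ?thesis .
qed

text \<open>
  A turnback contributes \<open>-q\<close> at a positive and \<open>-q\<^sup>-\<^sup>1\<close> at a negative crossing, once the factor
  \<open>q\<close> of the pairing is included. The product is the sign and the power of \<open>q\<close> of the
  homological grading.
\<close>
lemma letter_coeffs_monomial: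
  assumes "I \<subseteq> {..<length w}"
  shows "(\<Prod>c\<in>turnbacks w I. letter_coeff (qt_monom (- 1) 0 ^ 2) (snd (w ! c))) * qt_monom (int (card (turnbacks w I))) 0
    = of_int (if even (int (card I) - int (n_neg w)) then 1 else - 1) * qt_monom (int (card I) - int (n_neg w)) 0"
proof -
  let ?S = "turnbacks w I"
  have "qt_monom (int (card ?S)) 0 = (\<Prod>c\<in>?S. qt_monom 1 0)"
    by (simp add: qt_monom_power)
  then have "(\<Prod>c\<in>?S. letter_coeff (qt_monom (- 1) 0 ^ 2) (snd (w ! c))) * qt_monom (int (card ?S)) 0
      = (\<Prod>c\<in>?S. letter_coeff (qt_monom (- 1) 0 ^ 2) (snd (w ! c)) * qt_monom 1 0)"
    by (simp add: prod.distrib)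
  also have "\<dots> = (\<Prod>c\<in>?S. - qt_monom (if snd (w ! c) then 1 else - 1) 0)"
    by (intro prod.cong) (auto simp: letter_coeff_def qt_monom_power qt_monom_mult)
  also have "\<dots> = of_int (if even (int (card I) - int (n_neg w)) then 1 else - 1) *
      qt_monom (int (card I) - int (n_neg w)) 0"
    by (subst prod_odd_monomials[OF finite_turnbacks]) (simp_all only: sum_turnback_signs[OF assms], auto)
  finally show ?thesis .
qed

theorem theorem4:
  fixes n :: nat and w :: braid_word
  assumes "1 \<le> n" and "is_braid_word n w"
  shows "skh_euler_at n w (int n - 2) =
     qt_monom (int n - 2) (int n - 2) * qt_monom (int (n_pos w) - int (n_neg w)) 0 *
     mat_trace (burau (qt_monom 2 0) (qt_monom (- 2) 0) n w)"
proof -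
  let ?k = "int n - 2"
  let ?x = "qt_monom 1 0" and ?y = "qt_monom (- 1) 0"
  let ?M = "Pow {..<length w}"
  let ?u = "\<lambda>I. int (card I) - int (n_neg w)"
  let ?sg = "\<lambda>i :: int. of_int (if even i then 1 else - 1) :: laurent_qt"
  let ?E = "\<lambda>I. {P. P \<subseteq> circles n w I \<and> (\<Sum>C\<in>nontrivial_circles n w I. v_sign P C) = ?k}"
  let ?K = "\<lambda>S. \<Prod>c\<in>S. letter_coeff (?y ^ 2) (snd (w ! c))"
  let ?shift = "qt_monom (int (n_pos w) - int (n_neg w)) 0"
  have "{x \<in> skh_gens n w. k_grade n w x = ?k} = Sigma ?M ?E"
    by (auto simp: skh_gens_def)
  then have "skh_euler_at n w ?k = (\<Sum>(I, P)\<in>Sigma ?M ?E.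
      ?sg (h_grade w (I, P)) * qt_monom (q_grade n w (I, P)) ?k)"
    by (simp only: euler_characteristic_eq_generators case_prod_unfold prod.collapse)
  also have "\<dots> = (\<Sum>I\<in>?M. \<Sum>P\<in>?E I. ?sg (h_grade w (I, P)) * qt_monom (q_grade n w (I, P)) ?k)"
    by (intro sum.Sigma[symmetric]) (auto simp: finite_circles)
  also have "\<dots> = (\<Sum>I\<in>?M. ?sg (?u I) * qt_monom (?u I) 0 * ?shift *
      (\<Sum>P\<in>?E I. qt_monom (\<Sum>C\<in>circles n w I. v_sign P C) ?k))"
    by (intro sum.cong refl)
      (simp add: sum_distrib_left mult.assoc qt_monom_mult algebra_simps)
  also have "\<dots> = (\<Sum>I\<in>?M. qt_monom ?k ?k * ?shift *
      (?K (turnbacks w I) * tl_weight ?x ?y n w (turnbacks w I)))"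
  proof (rule sum.cong[OF refl])
    fix I assume "I \<in> ?M"
    then have I: "I \<subseteq> {..<length w}" by simp
    let ?V = "\<Sum>P\<in>?E I. qt_monom (\<Sum>C\<in>circles n w I. v_sign P C) ?k"
    have "?sg (?u I) * qt_monom (?u I) 0 * ?shift * ?V
        = ?K (turnbacks w I) * qt_monom (int (card (turnbacks w I))) 0 * ?shift * ?V"
      by (simp only: letter_coeffs_monomial[OF I])
    also have "\<dots> = ?shift * ?K (turnbacks w I) * (qt_monom (int (card (turnbacks w I))) 0 * ?V)"
      by (simp only: ac_simps)
    also have "\<dots> = ?shift * ?K (turnbacks w I) * (qt_monom ?k ?k * tl_weight ?x ?y n w (turnbacks w I))"
      by (simp only: resolution_weight[OF assms])
    finally show "?sg (?u I) * qt_monom (?u I) 0 * ?shift * ?V = qt_monom ?k ?k * ?shift *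
        (?K (turnbacks w I) * tl_weight ?x ?y n w (turnbacks w I))"
      by (simp only: ac_simps)
  qed
  also have "\<dots> = (\<Sum>S\<in>?M. qt_monom ?k ?k * ?shift * (?K S * tl_weight ?x ?y n w S))"
    by (rule sum.reindex_bij_witness[where i = "turnbacks w" and j = "turnbacks w"])
      (use turnbacks_subset[of w] in \<open>auto simp: turnbacks_involution\<close>)
  also have "\<dots> = qt_monom ?k ?k * ?shift * mat_trace (burau (?x ^ 2) (?y ^ 2) n w)"
    using burau_trace_expansion[OF _ assms(2), of ?x ?y]
    by (simp add: sum_distrib_left qt_monom_mult qt_monom_0)
  finally show ?thesis by (simp add: qt_monom_power)
qed

end
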